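(* Let $k,n$ be positive integers, let $\psi:\mathbb{C}[\mathcal{P}_{kn}^k]\to\mathbb{C}[\mathcal{B}_{kn}^k]$ be the linear extension of $(d,\omega)\mapsto\underline{\omega}_n$, and let $\mathcal{I}_{kn}^k$ be the subalgebra of $\mathbb{C}[\mathcal{P}_{kn}^k]$ generated by the formal sums $\mathbf{C}_{\Lambda;n}$ of the elements of the conjugacy classes $C_{\Lambda;n}$, $|\Lambda|\le n$. Then $$\psi(\mathcal{I}_{kn}^k)=Z(\mathbb{C}[\mathcal{B}_{kn}^k]),$$ and for any family of partitions $\Lambda$ with $|\Lambda|<n$, $$\psi(\mathbf{C}_{\Lambda;n})=\binom{n-|\Lambda|+m_1(\Lambda(1^k))}{m_1(\Lambda(1^k))}\mathbf{C}_{\underline{\Lambda}_n}.$$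
   Context: Fix a positive integer $k$. For $i\ge1$ let $p_k(i)=\{(i-1)k+1,\dots,ik\}$; such a set is called a $k$-tuple. For a finite disjoint union $d$ of $k$-tuples, $\mathcal{B}_d^k$ is the group of permutations of $d$ that permute the $k$-tuples contained in $d$; $\mathcal{B}_{kn}^k=\mathcal{B}_{[kn]}^k$ where $[kn]=\{1,\dots,kn\}$. $Z(\cdot)$ denotes the center of an algebra. A family of partitions is $\Lambda=(\Lambda(\lambda))_{\lambda\vdash k}$, where each $\Lambda(\lambda)$ is a (possibly empty) partition; $|\Lambda|=\sum_{\lambda\vdash k}|\Lambda(\lambda)|$. $(1^k)$ is the partition of $k$ with all parts $1$, and $m_1(\mu)$ is the number of parts equal to $1$ in a partition $\mu$. For $n\ge|\Lambda|$, $\underline{\Lambda}_n$ is obtained from $\Lambda$ by adding $n-|\Lambda|$ parts equal to $1$ to $\Lambda(1^k)$. Type: for $\omega\in\mathcal{B}_d^k$, consider each cycle, of length $m$ say, of the permutation induced by $\omega$ on the $k$-tuples of $d$. The union of the $k$-tuples in this cycle is a union of cycles of $\omega$; choose one of these $k$-tuples $p_k(i)$ and let $\rho\vdash k$ be the partition formed by the numbers of elements of $p_k(i)$ lying in each of these cycles of $\omega$ (independent of $i$). This contributes one part $m$ to a partition denoted $\omega(\rho)$. The type of $\omega$ is the family $(\omega(\rho))_{\rho\vdash k}$. The conjugacy classes of $\mathcal{B}_{kn}^k$ are the sets $C_\Lambda$ of elements of type $\Lambda$, $|\Lambda|=n$; $\mathbf{C}_\Lambda$ is the sum of the elements of $C_\Lambda$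 in $\mathbb{C}[\mathcal{B}_{kn}^k]$. A $k$-partial permutation of $n$ is a pair $(d,\omega)$ with $d\subset[kn]$ a disjoint union of $k$-tuples and $\omega\in\mathcal{B}_d^k$; $\mathcal{P}_{kn}^k$ is the set of all of them, a semigroup under $(d_1,\omega_1)(d_2,\omega_2)=(d_1\cup d_2,\omega_1\omega_2)$, where $\omega_1,\omega_2$ are extended by the identity to $d_1\cup d_2$. $\underline{\omega}_n\in\mathcal{B}_{kn}^k$ is the extension of $\omega$ to $[kn]$ by the identity. The group $\mathcal{B}_{kn}^k$ acts on $\mathcal{P}_{kn}^k$ by $\sigma.(d,\omega)=(\sigma(d),\sigma\omega\sigma^{-1})$, and the orbits (called conjugacy classes) are the sets $C_{\Lambda;n}=\{(d,\omega)\in\mathcal{P}_{kn}^k:\ |d|=k|\Lambda|,\ \omega\text{ has type }\Lambda\}$ for families $\Lambda$ with $|\Lambda|\le n$. *)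

theory Defs
  imports
    "HOL-Library.Multiset"
    "HOL-Library.Indicator_Function"
    "HOL-Algebra.Module"
    "HOL-Combinatorics.Orbits"
    Complex_Main
begin

section \<open>Monoid algebras over the complex numbers\<close>

text \<open>
  Formal linear combinations of elements of a monoid \<open>G\<close> are coefficient functions of finite
  support contained in \<open>carrier G\<close>; a basis vector \<open>x\<close> is \<open>indicator {x}\<close>, and the formal sum
  of the elements of a finite set \<open>C\<close> is \<open>indicator C\<close>. The product is convolution.
\<close>

definition monoid_algebra :: "('a, 'm) monoid_scheme \<Rightarrow> (complex, 'a \<Rightarrow> complex) module" where
  "monoid_algebra G =
    \<lparr> carrier = {f. finite {x. f x \<noteq> 0} \<and> {x. f x \<noteq> 0} \<subseteq> carrier G},
      monoid.mult = (\<lambda>f g z. \<Sum>x | f x \<noteq> 0. \<Sum>y | g y \<noteq> 0. if x \<otimes>\<^bsub>G\<^esub> y = z then f x * g y else 0),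
      one = indicator {\<one>\<^bsub>G\<^esub>},
      zero = (\<lambda>_. 0),
      add = (\<lambda>f g x. f x + g x),
      smult = (\<lambda>c f x. c * f x) \<rparr>"

definition linear_extension :: "('a \<Rightarrow> 'b) \<Rightarrow> ('a \<Rightarrow> complex) \<Rightarrow> ('b \<Rightarrow> complex)" where
  "linear_extension \<phi> f = (\<lambda>y. \<Sum>x | f x \<noteq> 0. if \<phi> x = y then f x else 0)"

definition algebra_center :: "('a, 'b, 'm) module_scheme \<Rightarrow> 'b set" where
  "algebra_center A = {x \<in> carrier A. \<forall>y \<in> carrier A. x \<otimes>\<^bsub>A\<^esub> y = y \<otimes>\<^bsub>A\<^esub> x}"

inductive_set generate_algebra :: "(complex, 'b, 'm) module_scheme \<Rightarrow> 'b set \<Rightarrow> 'b set"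
  for A and S where
    zero: "\<zero>\<^bsub>A\<^esub> \<in> generate_algebra A S"
  | one: "\<one>\<^bsub>A\<^esub> \<in> generate_algebra A S"
  | incl: "s \<in> S \<Longrightarrow> s \<in> generate_algebra A S"
  | add: "\<lbrakk>x \<in> generate_algebra A S; y \<in> generate_algebra A S\<rbrakk>
      \<Longrightarrow> x \<oplus>\<^bsub>A\<^esub> y \<in> generate_algebra A S"
  | mult: "\<lbrakk>x \<in> generate_algebra A S; y \<in> generate_algebra A S\<rbrakk>
      \<Longrightarrow> x \<otimes>\<^bsub>A\<^esub> y \<in> generate_algebra A S"
  | smult: "x \<in> generate_algebra A S \<Longrightarrow> c \<odot>\<^bsub>A\<^esub> x \<in> generate_algebra A S"


section \<open>Families of partitions\<close>

text \<open>A partition is the multiset of its (positive) parts.\<close>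

definition partitions_of :: "nat \<Rightarrow> nat multiset set" where
  "partitions_of k = {\<rho>. 0 \<notin># \<rho> \<and> sum_mset \<rho> = k}"

text \<open>
  A family indexed by the partitions of \<open>k\<close> is a total function that takes the value \<open>{#}\<close>
  outside \<open>partitions_of k\<close>, so that equality of families is equality of functions.
\<close>

definition partition_families :: "nat \<Rightarrow> (nat multiset \<Rightarrow> nat multiset) set" where
  "partition_families k =
    {\<Lambda>. (\<forall>\<rho> \<in> partitions_of k. 0 \<notin># \<Lambda> \<rho>) \<and> (\<forall>\<rho>. \<rho> \<notin> partitions_of k \<longrightarrow> \<Lambda> \<rho> = {#})}"

definition family_size :: "nat \<Rightarrow> (nat multiset \<Rightarrow> nat multiset) \<Rightarrow> nat" where
  "family_size k \<Lambda> = (\<Sum>\<rho> \<in> partitions_of k. sum_mset (\<Lambda> \<rho>))"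

definition ones :: "nat \<Rightarrow> nat multiset" where
  "ones k = replicate_mset k 1"

definition complete_family ::
    "nat \<Rightarrow> nat \<Rightarrow> (nat multiset \<Rightarrow> nat multiset) \<Rightarrow> (nat multiset \<Rightarrow> nat multiset)" where
  "complete_family k n \<Lambda> =
    \<Lambda>(ones k := \<Lambda> (ones k) + replicate_mset (n - family_size k \<Lambda>) 1)"


section \<open>The groups of permutations of tuples and the partial permutations\<close>

definition ktuple :: "nat \<Rightarrow> nat \<Rightarrow> nat set" where
  "ktuple k i = {(i - 1) * k + 1..i * k}"

definition is_ktuple_union :: "nat \<Rightarrow> nat set \<Rightarrow> bool" where
  "is_ktuple_union k d \<longleftrightarrow> (\<exists>I. finite I \<and> I \<subseteq> {1..} \<and> d = (\<Union>i \<in> I. ktuple k i))"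

definition ktuples_in :: "nat \<Rightarrow> nat set \<Rightarrow> nat set set" where
  "ktuples_in k d = {p. p \<subseteq> d \<and> (\<exists>i \<ge> 1. p = ktuple k i)}"

text \<open>
  A permutation of \<open>d\<close> is a function on all natural numbers that is the identity outside \<open>d\<close>
  (\<^const>\<open>permutes\<close>). Hence extending a permutation by the identity to a larger set does not
  change the function.
\<close>

definition Bperms :: "nat \<Rightarrow> nat set \<Rightarrow> (nat \<Rightarrow> nat) set" where
  "Bperms k d =
    {\<omega>. \<omega> permutes d \<and> bij_betw (\<lambda>p. \<omega> ` p) (ktuples_in k d) (ktuples_in k d)}"

definition Bgroup :: "nat \<Rightarrow> nat \<Rightarrow> (nat \<Rightarrow> nat) monoid" where
  "Bgroup k n = \<lparr> carrier = Bperms k {1..k * n}, monoid.mult = (\<circ>), one = id \<rparr>"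

definition partial_perms :: "nat \<Rightarrow> nat \<Rightarrow> (nat set \<times> (nat \<Rightarrow> nat)) monoid" where
  "partial_perms k n =
    \<lparr> carrier = {(d, \<omega>). d \<subseteq> {1..k * n} \<and> is_ktuple_union k d \<and> \<omega> \<in> Bperms k d},
      monoid.mult = (\<lambda>(d1, \<omega>1) (d2, \<omega>2). (d1 \<union> d2, \<omega>1 \<circ> \<omega>2)),
      one = ({}, id) \<rparr>"


section \<open>Types and conjugacy classes\<close>

definition tuple_cycles :: "nat \<Rightarrow> nat set \<Rightarrow> (nat \<Rightarrow> nat) \<Rightarrow> nat set set set" where
  "tuple_cycles k d \<omega> = orbit (\<lambda>p. \<omega> ` p) ` ktuples_in k d"

text \<open>
  The partition of \<open>k\<close> attached to a cycle \<open>c\<close> of tuples; \<open>orbit \<omega> ` \<Union>c\<close> is the set of (supports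
  of) cycles of \<open>\<omega>\<close>, including fixed points, whose union is \<open>\<Union>c\<close>.
\<close>

definition cycle_partition :: "(nat \<Rightarrow> nat) \<Rightarrow> nat set set \<Rightarrow> nat multiset" where
  "cycle_partition \<omega> c =
    (let p = (SOME p. p \<in> c)
     in image_mset (\<lambda>z. card (p \<inter> z)) (mset_set (orbit \<omega> ` \<Union>c)))"

definition perm_type :: "nat \<Rightarrow> nat set \<Rightarrow> (nat \<Rightarrow> nat) \<Rightarrow> (nat multiset \<Rightarrow> nat multiset)" where
  "perm_type k d \<omega> =
    (\<lambda>\<rho>. image_mset card (mset_set {c \<in> tuple_cycles k d \<omega>. cycle_partition \<omega> c = \<rho>}))"

definition conj_class :: "nat \<Rightarrow> nat \<Rightarrow> (nat multiset \<Rightarrow> nat multiset) \<Rightarrow> (nat \<Rightarrow> nat) set" where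
  "conj_class k n \<Lambda> = {\<omega> \<in> carrier (Bgroup k n). perm_type k {1..k * n} \<omega> = \<Lambda>}"

definition partial_conj_class ::
    "nat \<Rightarrow> nat \<Rightarrow> (nat multiset \<Rightarrow> nat multiset) \<Rightarrow> (nat set \<times> (nat \<Rightarrow> nat)) set" where
  "partial_conj_class k n \<Lambda> =
    {(d, \<omega>) \<in> carrier (partial_perms k n). card d = k * family_size k \<Lambda> \<and> perm_type k d \<omega> = \<Lambda>}"


section \<open>The algebra of class sums and the projection\<close>

definition invariant_algebra :: "nat \<Rightarrow> nat \<Rightarrow> (nat set \<times> (nat \<Rightarrow> nat) \<Rightarrow> complex) set" where
  "invariant_algebra k n = generate_algebra (monoid_algebra (partial_perms k n))
    {indicator (partial_conj_class k n \<Lambda>) | \<Lambda>. \<Lambda> \<in> partition_families k \<and> family_size k \<Lambda> \<le> n}"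

text \<open>By the convention above, the extension of \<open>\<omega>\<close> to \<open>{1..k * n}\<close> in \<open>(d, \<omega>)\<close> is \<open>\<omega>\<close> itself.\<close>

definition psi :: "(nat set \<times> (nat \<Rightarrow> nat) \<Rightarrow> complex) \<Rightarrow> ((nat \<Rightarrow> nat) \<Rightarrow> complex)" where
  "psi = linear_extension (\<lambda>(d, \<omega>). \<omega>)"

end

(*
  Classes by type are conjugacy classes: given two elements of the same type, match the cycles of
  tuples so that lengths and partitions agree, then inside a cycle match the orbits of points so
  that the intersections with chosen base tuples p and p' have equal sizes. Sending the m-th iterate
  of a base point in p to the m-th iterate of the matching base point in p' is well defined because
  matching orbits have equal lengths, and it maps tuples to tuples because the two cycles of tuples
  have equal lengths. Hence the center consists of the combinations of the class sums, which are
  images of the C_{Lambda;n} with |Lambda| = n. Conversely, conjugation by an element of the group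
  is an automorphism of the semigroup of partial permutations that fixes the generators of the
  invariant algebra, hence all of it, so every image under psi is a class function. The coefficient
  of w in the image of C_{Lambda;n} counts the sets of n - |Lambda| pointwise fixed tuples of w that
  can be removed from [kn].
*)
theory Submission
  imports Defs "HOL-Combinatorics.Cycles" "HOL-Library.Disjoint_Sets"
begin

section \<open>Permutations of a system of blocks\<close>

text \<open>The type of a partial permutation refers to a domain that varies with it, and the two
  operations that matter, conjugation and removal of fixed tuples, both change that domain. The
  combinatorics is therefore done for a finite system \<open>T\<close> of disjoint blocks of common
  size \<open>k\<close>, without reference to intervals, and specialised to
  \<open>ktuples_in k d\<close> afterwards. A permutation of \<open>d\<close> is a function that is
  the identity outside \<open>d\<close>, so \<open>psi\<close> merely forgets \<open>d\<close>, and
  a coefficient of the image of a class sum is a number of admissible domains. Enlarging a domain by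
  r fixed tuples adds r cycles of length 1 with partition \<open>ones k\<close>. Hence a
  \<open>w\<close> of completed type has n - |Lambda| + m_1(Lambda(1^k)) pointwise fixed tuples, of
  which n - |Lambda| are deleted; choosing the kept ones instead gives the binomial coefficient of
  the statement. Classes with |Lambda| = n reach the whole center because their domain can only be
  [kn], where \<open>psi\<close> loses nothing.\<close>

lemma funpow_eq_iff_mod_card_orbit:
  assumes "x \<in> orbit f x"
  shows "(f ^^ i) x = (f ^^ j) x \<longleftrightarrow> i mod card (orbit f x) = j mod card (orbit f x)"
proof -
  \<comment> \<open>The first return time to \<open>x\<close>: the iterates before it are distinct
    and exhaust the orbit.\<close>
  define m where "m = funpow_dist1 f x x"
  have orb: "orbit f x = (\<lambda>n. (f ^^ n) x) ` {0..<m}" and inj: "inj_on (\<lambda>n. (f ^^ n) x) {0..<m}"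
    using orbit_conv_funpow_dist1[OF assms] inj_on_funpow_dist1[OF assms] by (simp_all add: m_def)
  have card: "card (orbit f x) = m"
    unfolding orb by (simp add: card_image inj)
  have fm: "(f ^^ m) x = x"
    unfolding m_def by (rule funpow_dist1_prop[OF assms])
  have red: "(f ^^ i) x = (f ^^ (i mod m)) x" for i
    using fm by (rule funpow_mod_eq[symmetric])
  have "0 < m"
    by (simp add: m_def)
  then show ?thesis
    unfolding card using inj red[of i] red[of j]
    by (auto simp: inj_on_def)
qed

text \<open>Two indices name the same point exactly when they agree modulo the orbit size. This
  criterion is the same on both sides, so matching iterate with iterate is well defined and
  injective.\<close>

lemma orbit_bij_equivariant:
  assumes x: "x \<in> orbit f x" and x': "x' \<in> orbit f' x'"
    and card: "card (orbit f x) = card (orbit f' x')"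
  shows "\<exists>g. bij_betw g (orbit f x) (orbit f' x') \<and> (\<forall>n. g ((f ^^ n) x) = (f' ^^ n) x')"
proof -
  \<comment> \<open>Any index that reaches \<open>y\<close> serves; \<open>iff\<close> makes the
    choice immaterial.\<close>
  define g where "g y = (f' ^^ (SOME n. (f ^^ n) x = y)) x'" for y
  have iff: "(f ^^ i) x = (f ^^ j) x \<longleftrightarrow> (f' ^^ i) x' = (f' ^^ j) x'" for i j
    by (simp add: funpow_eq_iff_mod_card_orbit x x' card)
  have g: "g ((f ^^ n) x) = (f' ^^ n) x'" for n
  proof -
    have "(f ^^ (SOME i. (f ^^ i) x = (f ^^ n) x)) x = (f ^^ n) x"
      by (rule someI[of "\<lambda>i. (f ^^ i) x = (f ^^ n) x" n]) simp
    then show ?thesis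
      unfolding g_def by (simp only: iff)
  qed
  have "bij_betw g (orbit f x) (orbit f' x')"
    unfolding bij_betw_def orbit_altdef_self_in[OF x] orbit_altdef_self_in[OF x']
    by (auto simp: inj_on_def g iff image_def)
  with g show ?thesis
    by blast
qed

text \<open>Converts an equality of multisets, which is what types and cycle partitions provide,
  into a label-preserving bijection. It is used once for cycles of blocks and once for orbits of
  points inside a cycle.\<close>

lemma bij_betw_of_image_mset_eq:
  assumes "finite A" "finite B" "image_mset f (mset_set A) = image_mset g (mset_set B)"
  shows "\<exists>h. bij_betw h A B \<and> (\<forall>a \<in> A. g (h a) = f a)"
  using assms
proof (induction A arbitrary: B rule: finite_induct)
  case empty
  then have "B = {}"
    by (simp add: mset_set_empty_iff)
  then show ?case
    by (auto simp: bij_betw_def)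
next
  case (insert a A)
  have "f a \<in># image_mset g (mset_set B)"
    using insert.hyps insert.prems(2)[symmetric] by simp
  then obtain b where b: "b \<in> B" "g b = f a"
    using insert.prems(1) by auto
  have "mset_set B = add_mset b (mset_set (B - {b}))"
    using b insert.prems(1) by (simp add: mset_set.remove)
  then have "image_mset f (mset_set A) = image_mset g (mset_set (B - {b}))"
    using insert.hyps insert.prems(2) b by simp
  then obtain h where h: "bij_betw h A (B - {b})" "\<forall>a \<in> A. g (h a) = f a"
    using insert.IH[of "B - {b}"] insert.prems(1) by auto
  have "bij_betw (h(a := b)) A (B - {b})"
    using h(1) insert.hyps(2) by (subst bij_betw_cong[of A _ h]) auto
  then have "bij_betw (h(a := b)) (insert a A) (insert b (B - {b}))"
    using insert.hyps(2) notIn_Un_bij_betw[of a A "h(a := b)" "B - {b}"] by simp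
  then have "bij_betw (h(a := b)) (insert a A) B"
    using b by (simp add: insert_absorb)
  then show ?case
    using h(2) b insert.hyps(2) by (intro exI[of _ "h(a := b)"]) (auto simp del: fun_upd_apply, auto)
qed

lemma count_image_mset_mset_set:
  assumes "finite A"
  shows "count (image_mset f (mset_set A)) y = card {a \<in> A. f a = y}"
  using assms by (simp add: count_image_mset sum.If_cases vimage_def Int_def conj_commute)

lemma image_funpow: "((`) f ^^ n) A = (f ^^ n) ` A" for f :: "'a \<Rightarrow> 'a"
  by (induction n) (simp_all add: image_comp)

section \<open>Cycles of blocks and the orbits of points inside them\<close>

text \<open>This is \<open>perm_type\<close> with the system of blocks as a free parameter in place
  of \<open>ktuples_in k d\<close>, so that blocks can be removed or carried along a
  bijection.\<close>

definition block_type :: "nat set set \<Rightarrow> (nat \<Rightarrow> nat) \<Rightarrow> nat multiset \<Rightarrow> nat multiset" where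
  "block_type T w \<rho> = image_mset card (mset_set {c \<in> orbit ((`) w) ` T. cycle_partition w c = \<rho>})"

text \<open>Only the common size and the disjointness of tuples are kept. Since infinite sets have
  cardinality 0, \<open>k_pos\<close> together with \<open>card_block\<close> makes every block
  finite and nonempty.\<close>

locale block_permutation =
  fixes T :: "nat set set" and k :: nat and w :: "nat \<Rightarrow> nat"
  assumes finite_blocks: "finite T" and k_pos: "0 < k"
    and card_block: "p \<in> T \<Longrightarrow> card p = k"
    and block_eqI: "\<lbrakk>p \<in> T; q \<in> T; x \<in> p; x \<in> q\<rbrakk> \<Longrightarrow> p = q"
    and permutes_Union: "w permutes \<Union>T"
    and image_block: "p \<in> T \<Longrightarrow> w ` p \<in> T"
begin

lemma finite_block: "p \<in> T \<Longrightarrow> finite p"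
  using card_block k_pos card.infinite by force

lemma block_nonempty: "p \<in> T \<Longrightarrow> p \<noteq> {}"
  using card_block k_pos by force

lemma permutation: "permutation w"
  unfolding permutation_permutes using finite_blocks finite_block permutes_Union by blast

lemma inj_funpow: "inj (w ^^ n)"
  using permutation by (simp add: bij_is_inj permutation_bijective bij_fn)

lemma funpow_block: "p \<in> T \<Longrightarrow> (w ^^ n) ` p \<in> T"
  by (induction n) (simp_all only: funpow.simps image_comp[symmetric] image_block image_id id_apply)

lemma self_in_orbit: "x \<in> orbit w x"
  by (rule permutation_self_in_orbit[OF permutation])

text \<open>Some positive power of \<open>w\<close> is the identity, so every set returns to itself.
  This needs an argument because \<open>orbit\<close> starts with the first iterate, not with the
  zeroth.\<close>

lemma self_in_block_orbit: "p \<in> orbit ((`) w) p"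
proof -
  obtain n where "w ^^ n = id" "n > 0"
    using permutation_is_nilpotent[OF permutation] by blast
  then show ?thesis
    unfolding orbit_altdef image_funpow by (auto intro!: exI[of _ n])
qed

lemma block_orbit: "orbit ((`) w) p = {(w ^^ n) ` p | n. True}"
  using orbit_altdef_self_in[OF self_in_block_orbit] by (simp add: image_funpow)

lemma point_orbit: "orbit w x = {(w ^^ n) x | n. True}"
  by (rule orbit_altdef_self_in[OF self_in_orbit])

abbreviation cycles :: "nat set set set" where
  "cycles \<equiv> orbit ((`) w) ` T"

lemma cycle_subset: "c \<in> cycles \<Longrightarrow> c \<subseteq> T"
  by (auto simp: block_orbit funpow_block)

lemma finite_cycle: "c \<in> cycles \<Longrightarrow> finite c"
  by (meson cycle_subset finite_blocks finite_subset)

lemma cycle_nonempty: "c \<in> cycles \<Longrightarrow> c \<noteq> {}"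
  by (auto simp: orbit_nonempty)

lemma cycle_eq_orbit: "\<lbrakk>c \<in> cycles; p \<in> c\<rbrakk> \<Longrightarrow> c = orbit ((`) w) p"
  by (metis (no_types, lifting) cyclic_on_alldef cyclic_on_def imageE self_in_block_orbit)

lemma Union_cycles: "\<Union>(\<Union>cycles) = \<Union>T"
  using cycle_subset self_in_block_orbit by blast

lemma finite_Union_cycle: "c \<in> cycles \<Longrightarrow> finite (\<Union>c)"
  by (meson cycle_subset finite_Union finite_block finite_cycle subsetD)

lemma orbit_subset_cycle:
  assumes "c \<in> cycles" "x \<in> \<Union>c"
  shows "orbit w x \<subseteq> \<Union>c"
proof -
  obtain p where p: "p \<in> c" "x \<in> p"
    using assms by blast
  have "(w ^^ n) ` p \<in> c" for n
    using cycle_eq_orbit[OF assms(1) p(1)] block_orbit[of p] by blast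
  then show ?thesis
    using p by (auto simp: point_orbit)
qed

lemma Union_orbits_cycle: "c \<in> cycles \<Longrightarrow> \<Union>(orbit w ` \<Union>c) = \<Union>c"
  using orbit_subset_cycle self_in_orbit by blast

lemma orbit_eq_of_mem: "\<lbrakk>y \<in> orbit w x\<rbrakk> \<Longrightarrow> orbit w y = orbit w x"
  by (meson cyclic_on_orbit' orbit_cyclic_eq3 permutation)

lemma image_funpow_orbit: "(w ^^ n) ` orbit w x = orbit w x"
proof -
  have "w ` orbit w x = orbit w (w x)"
    by (rule orbit_inverse[OF self_in_orbit]) simp
  then have "w ` orbit w x = orbit w x"
    by (simp add: permutation_orbit_step permutation)
  then show ?thesis
    by (induction n) (simp_all only: funpow.simps image_comp[symmetric] image_id id_apply)
qed

text \<open>Some power of \<open>w\<close> carries \<open>p\<close> onto \<open>q\<close> and every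
  orbit of points onto itself, hence one intersection onto the other. This is why the partition of a
  cycle does not depend on the tuple picked by \<open>SOME\<close> in
  \<open>cycle_partition\<close>.\<close>

lemma card_block_Int_orbit:
  assumes "c \<in> cycles" "p \<in> c" "q \<in> c"
  shows "card (p \<inter> orbit w x) = card (q \<inter> orbit w x)"
proof -
  obtain n where "q = (w ^^ n) ` p"
    using cycle_eq_orbit[OF assms(1,2)] assms(3) block_orbit[of p] by blast
  then have "q \<inter> orbit w x = (w ^^ n) ` (p \<inter> orbit w x)"
    using image_Int[OF inj_funpow[of n]] image_funpow_orbit[of n x] by metis
  then show ?thesis
    by (metis card_image inj_funpow inj_on_subset subset_UNIV)
qed

lemma block_Int_orbit_nonempty:
  assumes "c \<in> cycles" "p \<in> c" "x \<in> \<Union>c"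
  shows "p \<inter> orbit w x \<noteq> {}"
proof -
  obtain q where "q \<in> c" "x \<in> q"
    using assms by blast
  moreover obtain n where "p = (w ^^ n) ` q"
    using cycle_eq_orbit[OF assms(1) \<open>q \<in> c\<close>] assms(2) block_orbit[of q] by blast
  ultimately show ?thesis
    by (auto simp: point_orbit)
qed

lemma cycle_partition_eq:
  assumes "c \<in> cycles" "p \<in> c"
  shows "cycle_partition w c = image_mset (\<lambda>z. card (p \<inter> z)) (mset_set (orbit w ` \<Union>c))"
proof -
  have "(SOME q. q \<in> c) \<in> c"
    using assms(2) by (rule someI)
  then show ?thesis
    unfolding cycle_partition_def Let_def using finite_Union_cycle[OF assms(1)]
    by (intro image_mset_cong) (auto intro: card_block_Int_orbit assms)
qed

text \<open>The orbit meets each block of the cycle in equally many points. So the length of an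
  orbit is determined by the length of its cycle and its part in the cycle partition, and orbits
  matched by these data have equal lengths.\<close>

lemma card_orbit:
  assumes "c \<in> cycles" "p \<in> c" "x \<in> \<Union>c"
  shows "card (orbit w x) = card c * card (p \<inter> orbit w x)"
proof -
  have "orbit w x = (\<Union>q \<in> c. q \<inter> orbit w x)"
    using orbit_subset_cycle[OF assms(1,3)] by blast
  then have "card (orbit w x) = card (\<Union>q \<in> c. q \<inter> orbit w x)"
    by simp
  also have "\<dots> = (\<Sum>q \<in> c. card (q \<inter> orbit w x))"
  proof (rule card_UN_disjoint)
    show "finite c"
      by (rule finite_cycle[OF assms(1)])
    show "\<forall>q \<in> c. finite (q \<inter> orbit w x)"
      using cycle_subset[OF assms(1)] finite_block by auto
    show "\<forall>q \<in> c. \<forall>r \<in> c. q \<noteq> r \<longrightarrow> q \<inter> orbit w x \<inter> (r \<inter> orbit w x) = {}"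
      using cycle_subset[OF assms(1)] block_eqI by blast
  qed
  also have "\<dots> = card c * card (p \<inter> orbit w x)"
    using card_block_Int_orbit[OF assms(1) _ assms(2)] by (simp add: sum_constant)
  finally show ?thesis .
qed

lemma disjoint_orbits: "disjoint (range (orbit w))"
  by (rule disjointI) (use orbit_eq_of_mem in blast)

text \<open>The orbits inside the cycle cut \<open>p\<close> into disjoint pieces, and none is empty
  because every such orbit visits every block of the cycle.\<close>

lemma cycle_partition_in_partitions_of:
  assumes "c \<in> cycles"
  shows "cycle_partition w c \<in> partitions_of k"
proof -
  obtain p where p: "p \<in> c"
    using cycle_nonempty[OF assms] by blast
  then have pT: "p \<in> T"
    using cycle_subset[OF assms] by blast
  let ?Z = "orbit w ` \<Union>c"
  have "p \<inter> z \<noteq> {}" if "z \<in> ?Z" for z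
    using that block_Int_orbit_nonempty[OF assms p] by auto
  then have pos: "0 \<notin># cycle_partition w c"
    using finite_block[OF pT] finite_Union_cycle[OF assms]
    by (force simp: cycle_partition_eq[OF assms p])
  have "sum_mset (cycle_partition w c) = (\<Sum>z \<in> ?Z. card (p \<inter> z))"
    by (simp add: cycle_partition_eq[OF assms p] sum_unfold_sum_mset)
  also have "\<dots> = card (\<Union>z \<in> ?Z. p \<inter> z)"
  proof (rule card_UN_disjoint[symmetric])
    show "\<forall>y \<in> ?Z. \<forall>z \<in> ?Z. y \<noteq> z \<longrightarrow> p \<inter> y \<inter> (p \<inter> z) = {}"
      using disjoint_orbits unfolding pairwise_def disjnt_def by blast
  qed (use finite_block[OF pT] finite_Union_cycle[OF assms] in auto)
  also have "(\<Union>z \<in> ?Z. p \<inter> z) = p"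
    using p self_in_orbit by blast
  finally show ?thesis
    using pos card_block[OF pT] by (simp add: partitions_of_def)
qed

end

section \<open>Permutations of equal type are conjugate\<close>

text \<open>Equivariance alone could be had orbit by orbit with arbitrary base points. Respecting
  blocks forces all base points of the cycle into one block \<open>p\<close>, and their partners
  into one block \<open>p'\<close>: the number of steps from a base point then determines the block
  reached.\<close>

lemma cycles_equivariant_bij:
  assumes w: "block_permutation T k w" and w': "block_permutation T' k w'"
    and c: "c \<in> orbit ((`) w) ` T" and c': "c' \<in> orbit ((`) w') ` T'"
    and card: "card c = card c'" and part: "cycle_partition w c = cycle_partition w' c'"
  shows "\<exists>g. bij_betw g (\<Union>c) (\<Union>c') \<and> (\<forall>x \<in> \<Union>c. g (w x) = w' (g x)) \<and> (\<forall>q \<in> c. g ` q \<in> c')"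
proof -
  interpret w: block_permutation T k w by (rule w)
  interpret w': block_permutation T' k w' by (rule w')
  let ?Z = "orbit w ` \<Union>c" and ?Z' = "orbit w' ` \<Union>c'"
  obtain p p' where p: "p \<in> c" and p': "p' \<in> c'"
    using w.cycle_nonempty[OF c] w'.cycle_nonempty[OF c'] by blast
  have c_eq: "c = orbit ((`) w) p" and c'_eq: "c' = orbit ((`) w') p'"
    using w.cycle_eq_orbit[OF c p] w'.cycle_eq_orbit[OF c' p'] by simp_all
  have "image_mset (\<lambda>z. card (p \<inter> z)) (mset_set ?Z) = image_mset (\<lambda>z. card (p' \<inter> z)) (mset_set ?Z')"
    using part by (simp add: w.cycle_partition_eq[OF c p] w'.cycle_partition_eq[OF c' p'])
  then obtain h where h: "bij_betw h ?Z ?Z'" and card_h: "\<And>z. z \<in> ?Z \<Longrightarrow> card (p' \<inter> h z) = card (p \<inter> z)"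
    using bij_betw_of_image_mset_eq[of ?Z ?Z' "\<lambda>z. card (p \<inter> z)" "\<lambda>z. card (p' \<inter> z)"]
      w.finite_Union_cycle[OF c] w'.finite_Union_cycle[OF c']
    by (metis finite_imageI)
  \<comment> \<open>For every orbit \<open>z\<close> the base points are taken from the same two
    blocks \<open>p\<close> and \<open>p'\<close>.\<close>
  have ex: "\<exists>u. bij_betw u z (h z) \<and> (\<exists>b \<in> p \<inter> z. \<exists>b' \<in> p'. \<forall>n. u ((w ^^ n) b) = (w' ^^ n) b')"
    if z: "z \<in> ?Z" for z
  proof -
    have hz: "h z \<in> ?Z'"
      using z bij_betwE[OF h] by blast
    obtain b where b: "b \<in> p" "b \<in> z"
      using z w.block_Int_orbit_nonempty[OF c p] by blast
    obtain b' where b': "b' \<in> p'" "b' \<in> h z"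
      using hz w'.block_Int_orbit_nonempty[OF c' p'] by blast
    have orb: "z = orbit w b" "h z = orbit w' b'"
      using z hz b b' w.orbit_eq_of_mem w'.orbit_eq_of_mem by auto
    have "card z = card (h z)"
      using w.card_orbit[OF c p UnionI[OF p b(1)]] w'.card_orbit[OF c' p' UnionI[OF p' b'(1)]]
        card_h[OF z] card orb by simp
    then obtain u where "bij_betw u z (h z)" "\<forall>n. u ((w ^^ n) b) = (w' ^^ n) b'"
      using orbit_bij_equivariant[OF w.self_in_orbit[of b] w'.self_in_orbit[of b']]
      by (metis orb)
    with b b' show ?thesis
      by blast
  qed
  from bchoice[OF ballI[OF ex]] obtain G where G: "\<forall>z \<in> ?Z. bij_betw (G z) z (h z) \<and>
    (\<exists>b \<in> p \<inter> z. \<exists>b' \<in> p'. \<forall>n. G z ((w ^^ n) b) = (w' ^^ n) b')" ..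
  define g where "g x = G (orbit w x) x" for x
  have g_eq: "g x = G z x" if "z \<in> ?Z" "x \<in> z" for x z
    using that w.orbit_eq_of_mem unfolding g_def by auto
  have "bij_betw g (\<Union>z \<in> ?Z. z) (\<Union>z \<in> ?Z. h z)"
  proof (rule bij_betw_UNION_disjoint)
    show "disjoint_family_on h ?Z"
      unfolding disjoint_family_on_def
    proof (intro ballI impI)
      fix y z assume yz: "y \<in> ?Z" "z \<in> ?Z" "y \<noteq> z"
      then have "h y \<noteq> h z" "h y \<in> ?Z'" "h z \<in> ?Z'"
        using inj_onD[OF bij_betw_imp_inj_on[OF h]] bij_betwE[OF h] by blast+
      then show "h y \<inter> h z = {}"
        using w'.disjoint_orbits unfolding pairwise_def disjnt_def by blast
    qed
    show "bij_betw g z (h z)" if "z \<in> ?Z" for z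
      using G that g_eq[OF that] bij_betw_cong[of z g "G z" "h z"] by blast
  qed
  moreover have "(\<Union>z \<in> ?Z. h z) = \<Union>c'"
    using h w'.Union_orbits_cycle[OF c'] by (simp add: bij_betw_def)
  ultimately have bij: "bij_betw g (\<Union>c) (\<Union>c')"
    using w.Union_orbits_cycle[OF c] by simp
  have base: "\<exists>m b b'. b \<in> p \<and> b' \<in> p' \<and> x = (w ^^ m) b \<and> (\<forall>n. g ((w ^^ n) b) = (w' ^^ n) b')"
    if x: "x \<in> \<Union>c" for x
  proof -
    have z: "orbit w x \<in> ?Z"
      using x by blast
    then obtain b b' where b: "b \<in> p" "b \<in> orbit w x" "b' \<in> p'"
      "\<And>n. G (orbit w x) ((w ^^ n) b) = (w' ^^ n) b'"
      using bspec[OF G z] by blast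
    have orb: "orbit w b = orbit w x"
      using b(2) by (rule w.orbit_eq_of_mem)
    then obtain m where "x = (w ^^ m) b"
      using w.self_in_orbit[of x] w.point_orbit[of b] by auto
    moreover have "g ((w ^^ n) b) = (w' ^^ n) b'" for n
      using g_eq[OF z, of "(w ^^ n) b"] b(4) w.point_orbit[of b] orb by auto
    ultimately show ?thesis
      using b by blast
  qed
  have equi: "g (w x) = w' (g x)" if x: "x \<in> \<Union>c" for x
  proof -
    obtain m b b' where "x = (w ^^ m) b" "\<And>n. g ((w ^^ n) b) = (w' ^^ n) b'"
      using base[OF x] by blast
    then show ?thesis
      by (metis comp_apply funpow.simps(2))
  qed
  have "g ` q \<in> c'" if q: "q \<in> c" for q
  proof -
    have pT: "p \<in> T" "p' \<in> T'" "q \<in> T"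
      using p p' q w.cycle_subset[OF c] w'.cycle_subset[OF c'] by auto
    obtain n where n: "q = (w ^^ n) ` p"
      using q c_eq w.block_orbit[of p] by auto
    have "g x \<in> (w' ^^ n) ` p'" if x: "x \<in> q" for x
    proof -
      obtain m b b' where b: "b \<in> p" "b' \<in> p'" "x = (w ^^ m) b" "g x = (w' ^^ m) b'"
        using base[of x] x q by blast
      \<comment> \<open>The two translates of \<open>p\<close> share the point \<open>x\<close>, so
        they coincide. Then \<open>m\<close> and \<open>n\<close> agree modulo the common length of
        the two cycles of blocks, and the corresponding translates of \<open>p'\<close> coincide
        too.\<close>
      have "(w ^^ m) ` p = (w ^^ n) ` p"
        using w.block_eqI[OF w.funpow_block[OF pT(1)] w.funpow_block[OF pT(1)], of x m n] b x n by auto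
      then have "(w' ^^ m) ` p' = (w' ^^ n) ` p'"
        using card c_eq c'_eq
          funpow_eq_iff_mod_card_orbit[OF w.self_in_block_orbit[of p], of m n]
          funpow_eq_iff_mod_card_orbit[OF w'.self_in_block_orbit[of p'], of m n]
        by (simp add: image_funpow)
      then show ?thesis
        using b by blast
    qed
    then have sub: "g ` q \<subseteq> (w' ^^ n) ` p'"
      by blast
    have "inj_on g q"
      using bij q by (auto simp: bij_betw_def intro: inj_on_subset)
    then have "card (g ` q) = card ((w' ^^ n) ` p')"
      using w.card_block[OF pT(3)] w'.card_block[OF w'.funpow_block[OF pT(2), of n]]
      by (simp add: card_image)
    then have "g ` q = (w' ^^ n) ` p'"
      using sub w'.finite_block[OF w'.funpow_block[OF pT(2), of n]] by (simp add: card_subset_eq)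
    then show ?thesis
      using c'_eq w'.block_orbit[of p'] by auto
  qed
  with bij equi show ?thesis
    by blast
qed

text \<open>Equal types match the cycles of \<open>w\<close> with those of \<open>w'\<close>; since
  distinct cycles cover disjoint sets of points, the bijections of the single cycles glue to one
  conjugating permutation.\<close>

lemma conjugate_of_block_type_eq:
  assumes w: "block_permutation T k w" and w': "block_permutation T k w'"
    and type: "block_type T w = block_type T w'"
  shows "\<exists>g. g permutes \<Union>T \<and> (\<forall>p \<in> T. g ` p \<in> T) \<and> g \<circ> w = w' \<circ> g"
proof -
  interpret w: block_permutation T k w by (rule w)
  interpret w': block_permutation T k w' by (rule w')
  let ?C = "w.cycles" and ?C' = "w'.cycles"
  \<comment> \<open>Labelling a cycle by the pair of its partition and its length turns the family
    of multisets into a single multiset, so that one bijection matches all cycles at once.\<close>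
  have count: "card {c \<in> orbit ((`) v) ` T. (cycle_partition v c, card c) = (\<rho>, m)} =
      count (block_type T v \<rho>) m" for v \<rho> m
    using w.finite_blocks
    by (simp add: block_type_def count_image_mset_mset_set conj_assoc)
  have eq: "image_mset (\<lambda>c. (cycle_partition w c, card c)) (mset_set ?C) =
      image_mset (\<lambda>c. (cycle_partition w' c, card c)) (mset_set ?C')"
  proof (rule multiset_eqI)
    show "count (image_mset (\<lambda>c. (cycle_partition w c, card c)) (mset_set ?C)) y =
      count (image_mset (\<lambda>c. (cycle_partition w' c, card c)) (mset_set ?C')) y" for y
      using w.finite_blocks count[of w "fst y" "snd y"] count[of w' "fst y" "snd y"] type
      by (simp add: count_image_mset_mset_set)
  qed
  from bij_betw_of_image_mset_eq[OF _ _ eq] w.finite_blocks obtain h where h: "bij_betw h ?C ?C'"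
    and "\<forall>c \<in> ?C. (cycle_partition w' (h c), card (h c)) = (cycle_partition w c, card c)"
    by auto
  then have h_eq: "cycle_partition w' (h c) = cycle_partition w c" "card (h c) = card c" if "c \<in> ?C" for c
    using that by auto
  have hC: "h c \<in> ?C'" if "c \<in> ?C" for c
    using that bij_betwE[OF h] by blast
  have "\<forall>c \<in> ?C. \<exists>g. bij_betw g (\<Union>c) (\<Union>(h c)) \<and> (\<forall>x \<in> \<Union>c. g (w x) = w' (g x)) \<and> (\<forall>q \<in> c. g ` q \<in> h c)"
    by (intro ballI cycles_equivariant_bij[OF w w'] hC) (simp_all add: h_eq)
  then obtain G where G: "\<forall>c \<in> ?C. bij_betw (G c) (\<Union>c) (\<Union>(h c)) \<and> (\<forall>x \<in> \<Union>c. G c (w x) = w' (G c x))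
    \<and> (\<forall>q \<in> c. G c ` q \<in> h c)"
    by (rule bchoice[THEN exE])
  \<comment> \<open>Each point of a block lies in the union of exactly one cycle, so the bijection
    to apply at it is unambiguous.\<close>
  define cyc where "cyc x = (THE c. c \<in> ?C \<and> x \<in> \<Union>c)" for x
  have cyc: "cyc x = c" if cx: "c \<in> ?C" "x \<in> \<Union>c" for x c
    unfolding cyc_def
  proof (rule the_equality)
    fix c' assume c': "c' \<in> ?C \<and> x \<in> \<Union>c'"
    obtain p q where pq: "p \<in> c" "x \<in> p" "q \<in> c'" "x \<in> q"
      using cx c' by blast
    then have "p = q"
      using w.block_eqI w.cycle_subset cx c' by blast
    then show "c' = c"
      using w.cycle_eq_orbit pq cx c' by metis
  qed (use cx in blast)
  define g where "g x = (if x \<in> \<Union>T then G (cyc x) x else x)" for x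
  have g_eq: "g x = G c x" if "c \<in> ?C" "x \<in> \<Union>c" for x c
    using that cyc[OF that] w.cycle_subset[OF that(1)] by (auto simp: g_def)
  have "bij_betw g (\<Union>c \<in> ?C. \<Union>c) (\<Union>c \<in> ?C. \<Union>(h c))"
  proof (rule bij_betw_UNION_disjoint)
    show "disjoint_family_on (\<lambda>c. \<Union>(h c)) ?C"
      unfolding disjoint_family_on_def
    proof (intro ballI impI)
      fix c d assume cd: "c \<in> ?C" "d \<in> ?C" "c \<noteq> d"
      then have ne: "h c \<noteq> h d" "h c \<in> ?C'" "h d \<in> ?C'"
        using inj_onD[OF bij_betw_imp_inj_on[OF h]] hC by blast+
      show "\<Union>(h c) \<inter> \<Union>(h d) = {}"
      proof (rule ccontr)
        assume "\<Union>(h c) \<inter> \<Union>(h d) \<noteq> {}"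
        then obtain x p q where pq: "p \<in> h c" "x \<in> p" "q \<in> h d" "x \<in> q"
          by blast
        then have "p = q"
          using w'.block_eqI w'.cycle_subset ne by blast
        then show False
          using w'.cycle_eq_orbit pq ne by metis
      qed
    qed
    show "bij_betw g (\<Union>c) (\<Union>(h c))" if "c \<in> ?C" for c
      using G that g_eq[OF that] bij_betw_cong[of "\<Union>c" g "G c" "\<Union>(h c)"] by blast
  qed
  moreover have "(\<Union>c \<in> ?C. \<Union>(h c)) = \<Union>(\<Union>(h ` ?C))" "(\<Union>c \<in> ?C. \<Union>c) = \<Union>(\<Union>?C)"
    by blast+
  moreover have "h ` ?C = ?C'"
    using h by (simp add: bij_betw_def)
  ultimately have "bij_betw g (\<Union>T) (\<Union>T)"
    using w.Union_cycles w'.Union_cycles by metis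
  then have perm: "g permutes \<Union>T"
    by (rule bij_imp_permutes) (simp add: g_def)
  have "g ` p \<in> T" if p: "p \<in> T" for p
  proof -
    have c: "orbit ((`) w) p \<in> ?C" "p \<in> orbit ((`) w) p"
      using p w.self_in_block_orbit by auto
    then have "g ` p = G (orbit ((`) w) p) ` p"
      by (intro image_cong refl g_eq) auto
    also have "\<dots> \<in> h (orbit ((`) w) p)"
      using G c by blast
    finally show ?thesis
      using w'.cycle_subset[OF hC[OF c(1)]] by blast
  qed
  moreover have "g \<circ> w = w' \<circ> g"
  proof (rule ext, unfold comp_apply)
    fix x
    show "g (w x) = w' (g x)"
    proof (cases "x \<in> \<Union>T")
      case True
      then have "x \<in> \<Union>(\<Union>?C)"
        by (simp only: w.Union_cycles)
      then obtain c where c: "c \<in> ?C" "x \<in> \<Union>c"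
        by (elim UnionE) blast
      then have "w x \<in> \<Union>c"
        using w.orbit_subset_cycle orbit.base[of w x] by blast
      then show ?thesis
        using G c g_eq by metis
    next
      case False
      then show ?thesis
        using w.permutes_Union w'.permutes_Union perm by (metis permutes_not_in)
    qed
  qed
  ultimately show ?thesis
    using perm by blast
qed

section \<open>Transport of the type along a bijection\<close>

text \<open>Keeps the inverse of a function apart from the group inverse, which is written
  \<open>inv\<close>.\<close>

abbreviation inv' :: "('a \<Rightarrow> 'b) \<Rightarrow> 'b \<Rightarrow> 'a" where
  "inv' f \<equiv> Hilbert_Choice.inv f"

lemma block_permutation_conj:
  assumes w: "block_permutation T k w" and s: "bij s"
  shows "block_permutation ((`) s ` T) k (s \<circ> w \<circ> inv' s)"
proof -
  interpret block_permutation T k w by (rule w)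
  have inv: "inv' s (s x) = x" for x
    using s by (simp add: bij_is_inj)
  show ?thesis
  proof
    show "finite ((`) s ` T)" "0 < k"
      using finite_blocks k_pos by simp_all
    show "card p = k" if "p \<in> (`) s ` T" for p
      using that card_block bij_is_inj[OF s] by (auto simp: card_image inj_on_subset)
    show "p = q" if "p \<in> (`) s ` T" "q \<in> (`) s ` T" "x \<in> p" "x \<in> q" for p q x
      using that block_eqI bij_is_inj[OF s] by (auto dest!: injD)
    have "bij w"
      using permutation by (rule permutation_bijective)
    then have "bij (s \<circ> w \<circ> inv' s)"
      using s by (intro bij_comp bij_imp_bij_inv)
    moreover have "(s \<circ> w \<circ> inv' s) x = x" if "x \<notin> \<Union>((`) s ` T)" for x
    proof -
      have "s (inv' s x) = x"
        using s by (simp add: bij_is_surj surj_f_inv_f)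
      then have "inv' s x \<notin> \<Union>T"
        using that by (metis UnionE UnionI imageI)
      then show ?thesis
        using permutes_Union s by (simp add: permutes_not_in bij_is_surj surj_f_inv_f)
    qed
    ultimately show "s \<circ> w \<circ> inv' s permutes \<Union>((`) s ` T)"
      unfolding permutes_def bij_iff by blast
    show "(s \<circ> w \<circ> inv' s) ` p \<in> (`) s ` T" if p: "p \<in> (`) s ` T" for p
    proof -
      obtain q where q: "q \<in> T" "p = s ` q"
        using p by blast
      then have "(s \<circ> w \<circ> inv' s) ` p = s ` (w ` q)"
        by (simp add: image_image inv)
      then show ?thesis
        using image_block q by blast
    qed
  qed
qed

text \<open>Conjugation carries orbits of points and cycles of blocks to their images under
  \<open>s\<close>, and a bijection preserves the sizes of cycles and of intersections, which are
  all that the type records.\<close>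

lemma block_type_conj:
  assumes w: "block_permutation T k w" and s: "bij s"
  shows "block_type ((`) s ` T) (s \<circ> w \<circ> inv' s) = block_type T w"
proof -
  interpret w: block_permutation T k w by (rule w)
  interpret w': block_permutation "(`) s ` T" k "s \<circ> w \<circ> inv' s"
    by (rule block_permutation_conj[OF w s])
  let ?w' = "s \<circ> w \<circ> inv' s"
  have inv: "inv' s (s x) = x" for x
    using s by (simp add: bij_is_inj)
  \<comment> \<open>One injectivity for sets of points and one for sets of blocks; the multisets
    over orbits and over cycles are reindexed by these maps without merging elements.\<close>
  have inj: "inj ((`) s)" "inj ((`) ((`) s))"
    using bij_is_inj[OF s] by (simp_all add: inj_on_image)
  have orb: "orbit ?w' (s x) = s ` orbit w x" for x
    by (rule orbit_inverse[OF w.self_in_orbit, symmetric]) (simp add: inv)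
  have block_orb: "orbit ((`) ?w') (s ` p) = (`) s ` orbit ((`) w) p" for p
    by (rule orbit_inverse[OF w.self_in_block_orbit, symmetric]) (simp add: inv image_image)
  have cycles: "w'.cycles = (`) ((`) s) ` w.cycles"
    by (simp only: image_image block_orb)
  have part: "cycle_partition ?w' ((`) s ` c) = cycle_partition w c" if c: "c \<in> w.cycles" for c
  proof -
    obtain p where p: "p \<in> c"
      using w.cycle_nonempty[OF c] by blast
    have orbits: "orbit ?w' ` \<Union>((`) s ` c) = (`) s ` (orbit w ` \<Union>c)"
      by (simp only: image_Union[symmetric] image_image orb)
    have card_Int: "card (s ` p \<inter> s ` z) = card (p \<inter> z)" for z
      using bij_is_inj[OF s] by (simp add: image_Int[symmetric] card_image inj_on_subset)
    have "cycle_partition ?w' ((`) s ` c) =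
        image_mset (\<lambda>z. card (s ` p \<inter> z)) (mset_set ((`) s ` (orbit w ` \<Union>c)))"
      using w'.cycle_partition_eq[of "(`) s ` c" "s ` p"] c p unfolding orbits cycles by blast
    also have "\<dots> = image_mset (\<lambda>z. card (s ` p \<inter> z)) (image_mset ((`) s) (mset_set (orbit w ` \<Union>c)))"
      using inj(1) by (simp add: image_mset_mset_set inj_on_subset)
    also have "\<dots> = cycle_partition w c"
      by (simp add: image_mset.compositionality comp_def card_Int w.cycle_partition_eq[OF c p])
    finally show ?thesis .
  qed
  show ?thesis
  proof
    fix \<rho>
    have "{c \<in> w'.cycles. cycle_partition ?w' c = \<rho>} =
        (`) ((`) s) ` {c \<in> w.cycles. cycle_partition w c = \<rho>}"
      unfolding cycles using part by (auto simp del: image_image)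
    then have "block_type ((`) s ` T) ?w' \<rho> =
        image_mset card (image_mset ((`) ((`) s)) (mset_set {c \<in> w.cycles. cycle_partition w c = \<rho>}))"
      using inj(2) unfolding block_type_def by (simp add: image_mset_mset_set inj_on_subset)
    also have "\<dots> = block_type T w \<rho>"
      using inj(1) by (simp add: block_type_def image_mset.compositionality comp_def card_image inj_on_subset)
    finally show "block_type ((`) s ` T) ?w' \<rho> = block_type T w \<rho>" .
  qed
qed

section \<open>Size of the type and removal of fixed blocks\<close>

text \<open>Positive parts with sum \<open>k\<close> are at most \<open>k\<close> in number and in
  size. Finiteness is what allows the sum in \<open>family_size\<close> to be regrouped as a sum
  over cycles.\<close>

lemma finite_partitions_of: "finite (partitions_of k)"
proof (rule finite_subset)
  show "partitions_of k \<subseteq> mset ` {xs. set xs \<subseteq> {0..k} \<and> length xs \<le> k}"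
  proof
    fix \<rho> assume \<rho>: "\<rho> \<in> partitions_of k"
    obtain xs where xs: "mset xs = \<rho>"
      using ex_mset by blast
    have "size \<rho> \<le> sum_mset \<rho>" if "0 \<notin># \<rho>" for \<rho> :: "nat multiset"
      using that by (induction \<rho>) auto
    then have "length xs \<le> k"
      using \<rho> xs by (metis (mono_tags, lifting) mem_Collect_eq partitions_of_def size_mset)
    moreover have "x \<le> sum_mset \<rho>" if "x \<in># \<rho>" for x
      using multi_member_split[OF that] by auto
    then have "set xs \<subseteq> {0..k}"
      using \<rho> xs by (auto simp: partitions_of_def)
    ultimately show "\<rho> \<in> mset ` {xs. set xs \<subseteq> {0..k} \<and> length xs \<le> k}"
      using xs by blast
  qed
qed (rule finite_imageI, rule finite_lists_length_le, simp)

context block_permutation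
begin

lemma block_type_in_partition_families: "block_type T w \<in> partition_families k"
proof -
  have "block_type T w \<rho> = {#}" if "\<rho> \<notin> partitions_of k" for \<rho>
  proof -
    have "{c \<in> cycles. cycle_partition w c = \<rho>} = {}"
      using that cycle_partition_in_partitions_of by blast
    then show ?thesis
      unfolding block_type_def by (simp only: mset_set.empty image_mset_empty)
  qed
  moreover have "0 \<notin># block_type T w \<rho>" for \<rho>
    using finite_blocks finite_cycle cycle_nonempty by (fastforce simp: block_type_def)
  ultimately show ?thesis
    by (simp add: partition_families_def)
qed

text \<open>Each cycle contributes its length once, under its own partition, and the cycles
  partition \<open>T\<close>.\<close>

lemma family_size_block_type: "family_size k (block_type T w) = card T"
proof -
  have fin: "finite cycles"
    using finite_blocks by simp
  have "family_size k (block_type T w) =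
      (\<Sum>\<rho> \<in> partitions_of k. \<Sum>c \<in> {c \<in> cycles. cycle_partition w c = \<rho>}. card c)"
    by (simp add: family_size_def block_type_def sum_unfold_sum_mset)
  also have "\<dots> = (\<Sum>c \<in> cycles. card c)"
    using cycle_partition_in_partitions_of by (intro sum.group fin finite_partitions_of) blast
  also have "\<dots> = card (\<Union>cycles)"
  proof (rule card_Union_disjoint[symmetric])
    show "disjoint cycles"
      by (rule disjointI) (use cycle_eq_orbit in blast)
  qed (rule finite_cycle)
  also have "\<Union>cycles = T"
    using cycle_subset self_in_block_orbit by blast
  finally show ?thesis .
qed

text \<open>Fixed pointwise, not just as sets: a block mapped to itself nontrivially also forms a
  cycle of length 1, but its partition has a part greater than 1.\<close>

definition fixed_blocks :: "nat set set" where
  "fixed_blocks = {p \<in> T. \<forall>x \<in> p. w x = x}"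

lemma fixed_block_orbit: "p \<in> fixed_blocks \<Longrightarrow> orbit ((`) w) p = {p}"
  by (auto simp: fixed_blocks_def orbit_eq_singleton_iff)

lemma cycle_partition_fixed_block:
  assumes "p \<in> fixed_blocks"
  shows "cycle_partition w {p} = ones k"
proof -
  have p: "p \<in> T" "\<And>x. x \<in> p \<Longrightarrow> w x = x"
    using assms by (auto simp: fixed_blocks_def)
  have "{p} \<in> cycles"
    using p(1) fixed_block_orbit[OF assms] by (metis imageI)
  then have "cycle_partition w {p} = image_mset (\<lambda>z. card (p \<inter> z)) (mset_set (orbit w ` p))"
    using cycle_partition_eq[of "{p}" p] by simp
  also have "orbit w ` p = (\<lambda>x. {x}) ` p"
    using p(2) by (intro image_cong) (auto simp: orbit_eq_singleton_iff)
  also have "mset_set ((\<lambda>x. {x}) ` p) = image_mset (\<lambda>x. {x}) (mset_set p)"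
    by (rule image_mset_mset_set[symmetric]) (simp add: inj_on_def)
  also have "image_mset (\<lambda>z. card (p \<inter> z)) (image_mset (\<lambda>x. {x}) (mset_set p)) =
      image_mset (\<lambda>x. 1) (mset_set p)"
    unfolding image_mset.compositionality
    using finite_block[OF p(1)] by (intro image_mset_cong) (auto simp: card_1_singleton_iff)
  also have "\<dots> = ones k"
    using card_block[OF p(1)] by (simp add: image_mset_const_eq ones_def)
  finally show ?thesis .
qed

text \<open>A cycle of length 1 is a single block, so its orbits lie inside that block and their
  sizes are the parts of the partition. All parts being 1, every orbit is a point.\<close>

lemma cycle_of_fixed_block:
  assumes c: "c \<in> cycles" and part: "cycle_partition w c = ones k" and "card c = 1"
  obtains p where "p \<in> fixed_blocks" "c = {p}"
proof -
  obtain p where cp: "c = {p}"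
    using assms(3) by (auto simp: card_1_singleton_iff)
  have pT: "p \<in> T"
    using cycle_subset[OF c] cp by blast
  have "w x = x" if x: "x \<in> p" for x
  proof -
    have "image_mset (\<lambda>z. card (p \<inter> z)) (mset_set (orbit w ` p)) = replicate_mset k 1"
      using part cycle_partition_eq[OF c, of p] cp by (simp add: ones_def)
    moreover have "card (p \<inter> orbit w x) \<in># image_mset (\<lambda>z. card (p \<inter> z)) (mset_set (orbit w ` p))"
      using x finite_block[OF pT] by simp
    ultimately have "card (p \<inter> orbit w x) = 1"
      by (metis in_replicate_mset)
    moreover have "orbit w x \<subseteq> p"
      using orbit_subset_cycle[OF c, of x] x cp by simp
    ultimately have "card (orbit w x) = 1"
      by (simp add: Int_absorb1)
    then obtain y where "orbit w x = {y}"
      by (auto simp: card_1_singleton_iff)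
    then show ?thesis
      using self_in_orbit[of x] orbit.base[of w x] by auto
  qed
  then show thesis
    using that[of p] pT cp by (auto simp: fixed_blocks_def)
qed

lemma count_block_type_ones: "count (block_type T w (ones k)) 1 = card fixed_blocks"
proof -
  have "{c \<in> cycles. cycle_partition w c = ones k \<and> card c = 1} = (\<lambda>p. {p}) ` fixed_blocks"
  proof (intro equalityI subsetI)
    fix c assume "c \<in> {c \<in> cycles. cycle_partition w c = ones k \<and> card c = 1}"
    then show "c \<in> (\<lambda>p. {p}) ` fixed_blocks"
      by (metis (mono_tags, lifting) cycle_of_fixed_block imageI mem_Collect_eq)
  next
    fix c assume "c \<in> (\<lambda>p. {p}) ` fixed_blocks"
    then obtain p where p: "p \<in> fixed_blocks" "c = {p}"
      by blast
    then have "c \<in> cycles"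
      using fixed_block_orbit[OF p(1)] by (auto simp: fixed_blocks_def image_iff)
    then show "c \<in> {c \<in> cycles. cycle_partition w c = ones k \<and> card c = 1}"
      using p cycle_partition_fixed_block by simp
  qed
  moreover have "count (block_type T w (ones k)) 1 =
      card {c \<in> cycles. cycle_partition w c = ones k \<and> card c = 1}"
    using finite_blocks by (simp add: block_type_def count_image_mset_mset_set conj_assoc)
  ultimately show ?thesis
    by (simp add: card_image inj_on_def)
qed

text \<open>Each fixed block is a cycle by itself with partition \<open>ones k\<close>, and removing
  it leaves the other cycles unchanged. This is where the parts added by
  \<open>complete_family\<close> come from.\<close>

lemma block_type_Diff_fixed_blocks:
  assumes S: "S \<subseteq> fixed_blocks"
  shows "block_type T w = (block_type (T - S) w)
    (ones k := block_type (T - S) w (ones k) + replicate_mset (card S) 1)"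
proof
  fix \<rho>
  have S_T: "S \<subseteq> T"
    using S by (auto simp: fixed_blocks_def)
  have fin: "finite T" "finite S"
    using finite_blocks finite_subset[OF S_T] by auto
  let ?C = "orbit ((`) w) ` (T - S)" and ?D = "(\<lambda>p. {p}) ` S"
  have "orbit ((`) w) ` S = ?D"
    using S fixed_block_orbit by (intro image_cong) auto
  then have cycles: "cycles = ?C \<union> ?D"
    using S_T by (metis Diff_partition Un_commute image_Un)
  \<comment> \<open>A cycle contains the block that generates it, so a block outside
    \<open>S\<close> cannot generate a singleton from \<open>S\<close>.\<close>
  have disj: "?C \<inter> ?D = {}"
  proof (rule ccontr)
    assume "?C \<inter> ?D \<noteq> {}"
    then obtain p q where "q \<in> T - S" "p \<in> S" "orbit ((`) w) q = {p}"
      by blast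
    then show False
      using self_in_block_orbit[of q] by simp
  qed
  have "cycle_partition w c = ones k" if "c \<in> ?D" for c
    using that by (auto intro: cycle_partition_fixed_block[OF subsetD[OF S]])
  then have D: "{c \<in> ?D. cycle_partition w c = \<rho>} = (if \<rho> = ones k then ?D else {})"
    by (simp only: split: if_split) blast
  have "mset_set {c \<in> cycles. cycle_partition w c = \<rho>} =
      mset_set ({c \<in> ?C. cycle_partition w c = \<rho>} \<union> {c \<in> ?D. cycle_partition w c = \<rho>})"
    by (simp only: cycles Un_iff conj_disj_distribR Collect_disj_eq)
  also have "\<dots> = mset_set {c \<in> ?C. cycle_partition w c = \<rho>} + mset_set {c \<in> ?D. cycle_partition w c = \<rho>}"
  proof (rule mset_set_Union)
    show "{c \<in> ?C. cycle_partition w c = \<rho>} \<inter> {c \<in> ?D. cycle_partition w c = \<rho>} = {}"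
      using disj by blast
  qed (simp_all add: fin)
  finally have "block_type T w \<rho> = block_type (T - S) w \<rho> +
      image_mset card (mset_set {c \<in> ?D. cycle_partition w c = \<rho>})"
    by (simp add: block_type_def)
  moreover have "image_mset card (mset_set ?D) = replicate_mset (card S) 1"
    by (simp add: image_mset_mset_set[symmetric] inj_on_def image_mset.compositionality comp_def
        image_mset_const_eq)
  ultimately show "block_type T w \<rho> = ((block_type (T - S) w)
      (ones k := block_type (T - S) w (ones k) + replicate_mset (card S) 1)) \<rho>"
    unfolding D by simp
qed

end

section \<open>Algebras of finite monoids\<close>

lemma carrier_monoid_algebra_finite:
  assumes "finite (carrier G)"
  shows "f \<in> carrier (monoid_algebra G) \<longleftrightarrow> (\<forall>x. x \<notin> carrier G \<longrightarrow> f x = 0)"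
  using assms by (auto simp: monoid_algebra_def intro: finite_subset)

text \<open>Summing over the whole carrier instead of the supports gives index sets independent of
  the factors, ready for reindexing by automorphisms.\<close>

lemma mult_monoid_algebra_finite:
  assumes fin: "finite (carrier G)"
    and f: "f \<in> carrier (monoid_algebra G)" and g: "g \<in> carrier (monoid_algebra G)"
  shows "(f \<otimes>\<^bsub>monoid_algebra G\<^esub> g) z =
    (\<Sum>x \<in> carrier G. \<Sum>y \<in> carrier G. if x \<otimes>\<^bsub>G\<^esub> y = z then f x * g y else 0)"
proof -
  have sub: "{x. f x \<noteq> 0} \<subseteq> carrier G" "{y. g y \<noteq> 0} \<subseteq> carrier G"
    using f g by (simp_all add: monoid_algebra_def)
  have "(f \<otimes>\<^bsub>monoid_algebra G\<^esub> g) z =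
      (\<Sum>x | f x \<noteq> 0. \<Sum>y | g y \<noteq> 0. if x \<otimes>\<^bsub>G\<^esub> y = z then f x * g y else 0)"
    by (simp add: monoid_algebra_def)
  also have "\<dots> = (\<Sum>x | f x \<noteq> 0. \<Sum>y \<in> carrier G. if x \<otimes>\<^bsub>G\<^esub> y = z then f x * g y else 0)"
    using sub fin by (intro sum.cong[OF refl] sum.mono_neutral_left) auto
  also have "\<dots> = (\<Sum>x \<in> carrier G. \<Sum>y \<in> carrier G. if x \<otimes>\<^bsub>G\<^esub> y = z then f x * g y else 0)"
    using sub fin by (intro sum.mono_neutral_left) (auto cong: if_cong)
  finally show ?thesis .
qed

lemma mult_closed_monoid_algebra_finite:
  assumes fin: "finite (carrier G)"
    and closed: "\<And>x y. \<lbrakk>x \<in> carrier G; y \<in> carrier G\<rbrakk> \<Longrightarrow> x \<otimes>\<^bsub>G\<^esub> y \<in> carrier G"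
    and f: "f \<in> carrier (monoid_algebra G)" and g: "g \<in> carrier (monoid_algebra G)"
  shows "f \<otimes>\<^bsub>monoid_algebra G\<^esub> g \<in> carrier (monoid_algebra G)"
proof -
  have "(f \<otimes>\<^bsub>monoid_algebra G\<^esub> g) z = 0" if "z \<notin> carrier G" for z
    unfolding mult_monoid_algebra_finite[OF fin f g]
    using that closed by (intro sum.neutral ballI) auto
  then show ?thesis
    unfolding carrier_monoid_algebra_finite[OF fin] by blast
qed

section \<open>Invariant subalgebras and the center of a group algebra\<close>

text \<open>An automorphism permutes the solutions of a product equation, so invariance survives
  convolution. Membership in the carrier is part of the induction because the convolution formula
  over the carrier requires it.\<close>

lemma generate_algebra_invariant:
  assumes fin: "finite (carrier G)" and one: "\<one>\<^bsub>G\<^esub> \<in> carrier G" "\<phi> \<one>\<^bsub>G\<^esub> = \<one>\<^bsub>G\<^esub>"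
    and closed: "\<And>x y. \<lbrakk>x \<in> carrier G; y \<in> carrier G\<rbrakk> \<Longrightarrow> x \<otimes>\<^bsub>G\<^esub> y \<in> carrier G"
    and \<phi>: "\<phi> \<in> iso G G"
    and S: "\<And>s. s \<in> S \<Longrightarrow> s \<in> carrier (monoid_algebra G) \<and> (\<forall>x \<in> carrier G. s (\<phi> x) = s x)"
    and f: "f \<in> generate_algebra (monoid_algebra G) S"
  shows "f \<in> carrier (monoid_algebra G) \<and> (\<forall>x \<in> carrier G. f (\<phi> x) = f x)"
  using f
proof (induction rule: generate_algebra.induct)
  case one
  have "inj_on \<phi> (carrier G)"
    using \<phi> by (simp add: iso_def bij_betw_def)
  then have "\<phi> x = \<one>\<^bsub>G\<^esub> \<longleftrightarrow> x = \<one>\<^bsub>G\<^esub>" if "x \<in> carrier G" for x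
    using that assms(2,3) by (metis inj_onD)
  then show ?case
    using assms(2) by (auto simp: carrier_monoid_algebra_finite[OF fin])
      (auto simp: monoid_algebra_def indicator_def)
next
  case (mult f g)
  have bij: "bij_betw \<phi> (carrier G) (carrier G)" and
    hom: "\<And>x y. \<lbrakk>x \<in> carrier G; y \<in> carrier G\<rbrakk> \<Longrightarrow> \<phi> (x \<otimes>\<^bsub>G\<^esub> y) = \<phi> x \<otimes>\<^bsub>G\<^esub> \<phi> y"
    using \<phi> by (simp_all add: iso_def hom_def)
  have fg: "f \<in> carrier (monoid_algebra G)" "g \<in> carrier (monoid_algebra G)"
    using mult by auto
  have "(f \<otimes>\<^bsub>monoid_algebra G\<^esub> g) (\<phi> z) = (f \<otimes>\<^bsub>monoid_algebra G\<^esub> g) z" if z: "z \<in> carrier G" for z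
  proof -
    have "(f \<otimes>\<^bsub>monoid_algebra G\<^esub> g) (\<phi> z) =
        (\<Sum>x \<in> carrier G. \<Sum>y \<in> carrier G. if \<phi> x \<otimes>\<^bsub>G\<^esub> \<phi> y = \<phi> z then f (\<phi> x) * g (\<phi> y) else 0)"
      unfolding mult_monoid_algebra_finite[OF fin fg]
      by (subst (1 2) sum.reindex_bij_betw[OF bij, symmetric]) (rule refl)
    also have "\<dots> = (\<Sum>x \<in> carrier G. \<Sum>y \<in> carrier G. if x \<otimes>\<^bsub>G\<^esub> y = z then f x * g y else 0)"
    proof (intro sum.cong refl)
      fix x y assume xy: "x \<in> carrier G" "y \<in> carrier G"
      have "\<phi> x \<otimes>\<^bsub>G\<^esub> \<phi> y = \<phi> z \<longleftrightarrow> x \<otimes>\<^bsub>G\<^esub> y = z"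
        using bij closed[OF xy] z unfolding hom[OF xy, symmetric] by (auto simp: bij_betw_def inj_on_def)
      then show "(if \<phi> x \<otimes>\<^bsub>G\<^esub> \<phi> y = \<phi> z then f (\<phi> x) * g (\<phi> y) else 0) =
          (if x \<otimes>\<^bsub>G\<^esub> y = z then f x * g y else 0)"
        using mult.IH xy by simp
    qed
    finally show ?thesis
      unfolding mult_monoid_algebra_finite[OF fin fg] .
  qed
  then show ?case
    using mult_closed_monoid_algebra_finite[OF fin _ fg] closed by blast
next
  case zero
  then show ?case
    by (simp add: carrier_monoid_algebra_finite[OF fin]) (simp add: monoid_algebra_def)
next
  case (incl s)
  then show ?case
    by (rule S)
next
  case (add f g)
  then show ?case
    by (simp add: carrier_monoid_algebra_finite[OF fin]) (simp add: monoid_algebra_def)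
next
  case (smult f c)
  then show ?case
    by (simp add: carrier_monoid_algebra_finite[OF fin]) (simp add: monoid_algebra_def)
qed

lemma sum_generate_algebra:
  assumes "finite L" "\<And>l. l \<in> L \<Longrightarrow> s l \<in> S"
  shows "(\<lambda>x. \<Sum>l \<in> L. c l * s l x) \<in> generate_algebra (monoid_algebra G) S"
  using assms
proof (induction L rule: finite_induct)
  case empty
  then show ?case
    using generate_algebra.zero[of "monoid_algebra G" S] by (simp add: monoid_algebra_def)
next
  case (insert l L)
  have "c l \<odot>\<^bsub>monoid_algebra G\<^esub> s l \<oplus>\<^bsub>monoid_algebra G\<^esub> (\<lambda>x. \<Sum>l \<in> L. c l * s l x)
      \<in> generate_algebra (monoid_algebra G) S"
    using insert by (intro generate_algebra.add[OF generate_algebra.smult[OF generate_algebra.incl]]) auto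
  then show ?case
    using insert.hyps by (simp add: monoid_algebra_def)
qed

text \<open>In a group each product equation has one solution for a given factor, so both
  convolutions collapse to single sums whose terms can be compared.\<close>

lemma (in group) algebra_center_group_algebra:
  assumes fin: "finite (carrier G)"
  shows "algebra_center (monoid_algebra G) = {f \<in> carrier (monoid_algebra G).
    \<forall>g \<in> carrier G. \<forall>x \<in> carrier G. f (g \<otimes> x \<otimes> inv g) = f x}"
proof -
  have left: "(f \<otimes>\<^bsub>monoid_algebra G\<^esub> h) z = (\<Sum>y \<in> carrier G. f (z \<otimes> inv y) * h y)"
    if "f \<in> carrier (monoid_algebra G)" "h \<in> carrier (monoid_algebra G)" "z \<in> carrier G" for f h z
  proof -
    have "(f \<otimes>\<^bsub>monoid_algebra G\<^esub> h) z =
        (\<Sum>y \<in> carrier G. \<Sum>x \<in> carrier G. if x \<otimes> y = z then f x * h y else 0)"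
      unfolding mult_monoid_algebra_finite[OF fin that(1,2)] by (rule sum.swap)
    also have "\<dots> = (\<Sum>y \<in> carrier G. \<Sum>x \<in> carrier G. if z \<otimes> inv y = x then f x * h y else 0)"
      using that(3) by (intro sum.cong refl if_cong) (metis inv_solve_right)
    also have "\<dots> = (\<Sum>y \<in> carrier G. f (z \<otimes> inv y) * h y)"
      using that(3) fin by (intro sum.cong refl) simp
    finally show ?thesis .
  qed
  have right: "(h \<otimes>\<^bsub>monoid_algebra G\<^esub> f) z = (\<Sum>y \<in> carrier G. h y * f (inv y \<otimes> z))"
    if "f \<in> carrier (monoid_algebra G)" "h \<in> carrier (monoid_algebra G)" "z \<in> carrier G" for f h z
  proof -
    have "(h \<otimes>\<^bsub>monoid_algebra G\<^esub> f) z =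
        (\<Sum>y \<in> carrier G. \<Sum>x \<in> carrier G. if inv y \<otimes> z = x then h y * f x else 0)"
      unfolding mult_monoid_algebra_finite[OF fin that(2,1)]
      using that(3) by (intro sum.cong refl if_cong) (metis inv_solve_left)
    also have "\<dots> = (\<Sum>y \<in> carrier G. h y * f (inv y \<otimes> z))"
      using that(3) fin by (intro sum.cong refl) simp
    finally show ?thesis .
  qed
  have "f \<otimes>\<^bsub>monoid_algebra G\<^esub> h = h \<otimes>\<^bsub>monoid_algebra G\<^esub> f"
    if f: "f \<in> carrier (monoid_algebra G)" and h: "h \<in> carrier (monoid_algebra G)"
      and inv: "\<forall>g \<in> carrier G. \<forall>x \<in> carrier G. f (g \<otimes> x \<otimes> inv g) = f x" for f h
  proof
    fix z
    show "(f \<otimes>\<^bsub>monoid_algebra G\<^esub> h) z = (h \<otimes>\<^bsub>monoid_algebra G\<^esub> f) z"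
    proof (cases "z \<in> carrier G")
      case True
      \<comment> \<open>Conjugating \<open>inv y \<otimes> z\<close> by \<open>y\<close> gives
        \<open>z \<otimes> inv y\<close>.\<close>
      have "f (z \<otimes> inv y) = f (inv y \<otimes> z)" if y: "y \<in> carrier G" for y
        using inv[rule_format, of y "inv y \<otimes> z"] y True by (simp add: m_assoc[symmetric])
      then show ?thesis
        unfolding left[OF f h True] right[OF f h True] by (intro sum.cong refl) simp
    next
      case False
      then show ?thesis
        using mult_closed_monoid_algebra_finite[OF fin _ f h] mult_closed_monoid_algebra_finite[OF fin _ h f]
        by (simp add: carrier_monoid_algebra_finite[OF fin])
    qed
  qed
  moreover have "f (g \<otimes> x \<otimes> inv g) = f x"
    if f: "f \<in> carrier (monoid_algebra G)" and g: "g \<in> carrier G" and x: "x \<in> carrier G"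
      and comm: "\<forall>h \<in> carrier (monoid_algebra G). f \<otimes>\<^bsub>monoid_algebra G\<^esub> h = h \<otimes>\<^bsub>monoid_algebra G\<^esub> f" for f g x
  proof -
    \<comment> \<open>Commutation with the basis vector of \<open>g\<close>, evaluated at
      \<open>g \<otimes> x\<close>, isolates exactly the two coefficients to be compared.\<close>
    have h: "indicator {g} \<in> carrier (monoid_algebra G)"
      using g by (auto simp: carrier_monoid_algebra_finite[OF fin] indicator_def)
    have gx: "g \<otimes> x \<in> carrier G"
      using g x by simp
    have "f (g \<otimes> x \<otimes> inv g) = (\<Sum>y \<in> carrier G. f (g \<otimes> x \<otimes> inv y) * indicator {g} y)"
      using fin g by (simp add: indicator_def)
    also have "\<dots> = (\<Sum>y \<in> carrier G. indicator {g} y * f (inv y \<otimes> (g \<otimes> x)))"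
      unfolding left[OF f h gx, symmetric] right[OF f h gx, symmetric] using comm h by simp
    also have "\<dots> = f (inv g \<otimes> (g \<otimes> x))"
      using fin g by (simp add: indicator_def)
    finally show ?thesis
      using g x by (simp add: m_assoc[symmetric])
  qed
  ultimately show ?thesis
    unfolding algebra_center_def by blast
qed

lemma linear_extension_finite:
  assumes "finite A" "{x. f x \<noteq> 0} \<subseteq> A"
  shows "linear_extension \<phi> f y = (\<Sum>x \<in> {x \<in> A. \<phi> x = y}. f x)"
proof -
  have "linear_extension \<phi> f y = (\<Sum>x | f x \<noteq> 0. if \<phi> x = y then f x else 0)"
    by (simp add: linear_extension_def)
  also have "\<dots> = (\<Sum>x \<in> A. if \<phi> x = y then f x else 0)"
    using assms by (intro sum.mono_neutral_left) auto
  finally show ?thesis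
    using assms(1) by (simp add: sum.inter_filter)
qed

section \<open>Permutations of tuples\<close>

lemma perm_type_eq_block_type: "perm_type k d w = block_type (ktuples_in k d) w"
  by (simp add: fun_eq_iff perm_type_def block_type_def tuple_cycles_def)

lemma card_ktuple: "1 \<le> i \<Longrightarrow> card (ktuple k i) = k"
  by (cases i) (simp_all add: ktuple_def)

lemma ktuple_eqI:
  assumes "x \<in> ktuple k i" "x \<in> ktuple k j" "1 \<le> i" "1 \<le> j"
  shows "i = j"
proof -
  have "\<not> i < j" if "x \<in> ktuple k i" "x \<in> ktuple k j" for i j
  proof
    assume "i < j"
    then have "i * k \<le> (j - 1) * k"
      by (intro mult_right_mono) auto
    then show False
      using that unfolding ktuple_def atLeastAtMost_iff by linarith
  qed
  then show ?thesis
    using assms by (meson linorder_neqE_nat)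
qed

lemma ktuples_in_subset: "p \<in> ktuples_in k d \<Longrightarrow> p \<subseteq> d"
  by (simp add: ktuples_in_def)

lemma card_ktuples_in: "p \<in> ktuples_in k d \<Longrightarrow> card p = k"
  by (auto simp: ktuples_in_def card_ktuple)

lemma ktuples_in_eqI:
  "\<lbrakk>p \<in> ktuples_in k d; q \<in> ktuples_in k e; x \<in> p; x \<in> q\<rbrakk> \<Longrightarrow> p = q"
  using ktuple_eqI by (fastforce simp: ktuples_in_def)

lemma finite_ktuples_in: "finite d \<Longrightarrow> finite (ktuples_in k d)"
  by (rule finite_subset[of _ "Pow d"]) (auto simp: ktuples_in_def)

text \<open>Replaces the index set in the definition by the canonical set of tuples contained in
  \<open>d\<close>, which is the block system needed by the locale.\<close>

lemma is_ktuple_union_iff: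
  assumes "0 < k"
  shows "is_ktuple_union k d \<longleftrightarrow> finite d \<and> \<Union>(ktuples_in k d) = d"
proof
  assume "is_ktuple_union k d"
  then obtain I where I: "finite I" "I \<subseteq> {1..}" "d = (\<Union>i \<in> I. ktuple k i)"
    by (auto simp: is_ktuple_union_def)
  then show "finite d \<and> \<Union>(ktuples_in k d) = d"
    by (auto simp: ktuples_in_def ktuple_def)
next
  assume d: "finite d \<and> \<Union>(ktuples_in k d) = d"
  let ?I = "{i \<in> {1..}. ktuple k i \<subseteq> d}"
  \<comment> \<open>The last element identifies its tuple, so the indices embed into the finite set
    \<open>d\<close>.\<close>
  have "i * k \<in> ktuple k i" if "1 \<le> i" for i
    using that assms by (cases i) (auto simp: ktuple_def)
  then have "(\<lambda>i. i * k) ` ?I \<subseteq> d"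
    by auto
  then have "finite ((\<lambda>i. i * k) ` ?I)"
    using d finite_subset by blast
  moreover have "inj_on (\<lambda>i. i * k) ?I"
    using assms by (auto simp: inj_on_def)
  ultimately have "finite ?I"
    by (rule finite_imageD)
  moreover have "d = (\<Union>i \<in> ?I. ktuple k i)"
    using d by (auto simp: ktuples_in_def)
  ultimately show "is_ktuple_union k d"
    unfolding is_ktuple_union_def by blast
qed

lemma is_ktuple_union_atLeastAtMost: "is_ktuple_union k {1..k * n}"
proof (cases "k = 0")
  case False
  have "{1..k * n} = (\<Union>i \<in> {1..n}. ktuple k i)"
  proof (intro equalityI subsetI)
    fix x assume x: "x \<in> {1..k * n}"
    \<comment> \<open>Points and tuples are both numbered from 1: the point is shifted down before
      the division and the quotient up after it.\<close>
    let ?i = "Suc ((x - 1) div k)"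
    have "(x - 1) div k < n"
      using x False by (intro less_mult_imp_div_less) (auto simp: mult.commute)
    moreover have "(x - 1) div k * k \<le> x - 1" "x - 1 < ?i * k"
      using False dividend_less_div_times[of k "x - 1"] by (auto simp: add.commute)
    then have "x \<in> ktuple k ?i"
      using x unfolding ktuple_def atLeastAtMost_iff diff_Suc_1 by linarith
    ultimately show "x \<in> (\<Union>i \<in> {1..n}. ktuple k i)"
      by (intro UN_I[of ?i]) auto
  next
    fix x assume "x \<in> (\<Union>i \<in> {1..n}. ktuple k i)"
    then obtain i where "1 \<le> i" "i \<le> n" "x \<in> ktuple k i"
      by auto
    moreover from this have "i * k \<le> k * n"
      by (simp add: mult.commute)
    ultimately show "x \<in> {1..k * n}"
      unfolding ktuple_def atLeastAtMost_iff by linarith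
  qed
  then show ?thesis
    unfolding is_ktuple_union_def by (intro exI[of _ "{1..n}"]) auto
qed (auto simp: is_ktuple_union_def intro!: exI[of _ "{}"])

lemma card_ktuple_union:
  assumes "0 < k" "is_ktuple_union k d"
  shows "card d = k * card (ktuples_in k d)"
proof -
  have d: "finite d" "\<Union>(ktuples_in k d) = d"
    using assms by (simp_all add: is_ktuple_union_iff)
  have "k * card (ktuples_in k d) = card (\<Union>(ktuples_in k d))"
  proof (rule card_partition)
    show "\<And>p. p \<in> ktuples_in k d \<Longrightarrow> card p = k"
      by (rule card_ktuples_in)
    show "\<And>p q. \<lbrakk>p \<in> ktuples_in k d; q \<in> ktuples_in k d; p \<noteq> q\<rbrakk> \<Longrightarrow> p \<inter> q = {}"
      using ktuples_in_eqI by blast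
  qed (use d finite_ktuples_in in auto)
  then show ?thesis
    using d by simp
qed

section \<open>The groups of permutations of tuples\<close>

text \<open>A permutation acts injectively on sets, and an injective map of the finitely many tuples
  into themselves is onto.\<close>

lemma Bperms_iff:
  assumes "0 < k" "is_ktuple_union k d"
  shows "w \<in> Bperms k d \<longleftrightarrow> w permutes d \<and> (\<forall>p \<in> ktuples_in k d. w ` p \<in> ktuples_in k d)"
proof -
  have "bij_betw ((`) w) (ktuples_in k d) (ktuples_in k d)"
    if w: "w permutes d" and im: "\<forall>p \<in> ktuples_in k d. w ` p \<in> ktuples_in k d"
  proof -
    have "inj_on ((`) w) (ktuples_in k d)"
      using permutes_inj[OF w] by (simp add: inj_on_image inj_on_subset)
    moreover have "finite (ktuples_in k d)"
      using assms by (simp add: is_ktuple_union_iff finite_ktuples_in)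
    moreover have "(`) w ` ktuples_in k d \<subseteq> ktuples_in k d"
      using im by blast
    ultimately show ?thesis
      by (simp add: bij_betw_def endo_inj_surj)
  qed
  then show ?thesis
    unfolding Bperms_def by (auto dest: bij_betwE)
qed

lemma block_permutation_Bperms:
  assumes "0 < k" "is_ktuple_union k d" "w \<in> Bperms k d"
  shows "block_permutation (ktuples_in k d) k w"
proof
  show "p = q" if "p \<in> ktuples_in k d" "q \<in> ktuples_in k d" "x \<in> p" "x \<in> q" for p q x
    using that by (rule ktuples_in_eqI)
qed (use assms in \<open>auto simp: Bperms_iff is_ktuple_union_iff finite_ktuples_in card_ktuples_in\<close>)

text \<open>A tuple of \<open>e\<close> that meets the union of tuples \<open>d\<close> lies in
  \<open>d\<close>; any other is fixed pointwise. So extension by the identity still permutes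
  tuples.\<close>

lemma Bperms_subset_iff:
  assumes k: "0 < k" and d: "is_ktuple_union k d" and e: "is_ktuple_union k e" and de: "d \<subseteq> e"
  shows "w \<in> Bperms k d \<longleftrightarrow> w \<in> Bperms k e \<and> w permutes d"
proof (intro iffI conjI)
  assume w: "w \<in> Bperms k d"
  then show perm: "w permutes d"
    by (simp add: Bperms_def)
  show "w \<in> Bperms k e"
    unfolding Bperms_iff[OF k e]
  proof (intro conjI ballI)
    show "w permutes e"
      using perm de by (rule permutes_subset)
    fix p assume p: "p \<in> ktuples_in k e"
    show "w ` p \<in> ktuples_in k e"
    proof (cases "p \<inter> d = {}")
      case True
      then have "w ` p = id ` p"
        using perm by (intro image_cong refl) (metis disjoint_iff id_apply permutes_not_in)
      then show ?thesis
        using p by simp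
    next
      case False
      then obtain x where "x \<in> p" "x \<in> d"
        by blast
      moreover from this have "x \<in> \<Union>(ktuples_in k d)"
        using d k by (simp add: is_ktuple_union_iff)
      ultimately have "p \<in> ktuples_in k d"
        using ktuples_in_eqI p by blast
      then have "w ` p \<in> ktuples_in k d"
        using w by (simp add: Bperms_iff[OF k d])
      then show ?thesis
        using de by (auto simp: ktuples_in_def)
    qed
  qed
next
  assume w: "w \<in> Bperms k e \<and> w permutes d"
  then show "w \<in> Bperms k d"
    unfolding Bperms_iff[OF k d] Bperms_iff[OF k e] using de
    by (auto simp: ktuples_in_def permutes_in_image subset_iff)
qed

lemma is_ktuple_union_Un:
  assumes "is_ktuple_union k d" "is_ktuple_union k e"
  shows "is_ktuple_union k (d \<union> e)"
proof -
  obtain I J where "finite I" "I \<subseteq> {1..}" "d = (\<Union>i \<in> I. ktuple k i)"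
    "finite J" "J \<subseteq> {1..}" "e = (\<Union>i \<in> J. ktuple k i)"
    using assms by (auto simp: is_ktuple_union_def)
  then show ?thesis
    unfolding is_ktuple_union_def by (intro exI[of _ "I \<union> J"]) auto
qed

lemma Bperms_comp:
  assumes "0 < k" "is_ktuple_union k d" "v \<in> Bperms k d" "w \<in> Bperms k d"
  shows "v \<circ> w \<in> Bperms k d"
proof -
  have "(v \<circ> w) ` p \<in> ktuples_in k d" if "p \<in> ktuples_in k d" for p
  proof -
    have "v ` (w ` p) \<in> ktuples_in k d"
      using assms that by (metis Bperms_iff)
    then show ?thesis
      by (simp only: image_comp)
  qed
  moreover have "v \<circ> w permutes d"
    using assms by (simp add: Bperms_iff permutes_compose)
  ultimately show ?thesis
    using assms(1,2) by (metis Bperms_iff)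
qed

lemma Bperms_inv:
  assumes "0 < k" "is_ktuple_union k d" "w \<in> Bperms k d"
  shows "inv' w \<in> Bperms k d"
proof -
  have w: "w permutes d" and bij: "bij_betw ((`) w) (ktuples_in k d) (ktuples_in k d)"
    using assms(3) by (auto simp: Bperms_def)
  have "inv' w ` p \<in> ktuples_in k d" if p: "p \<in> ktuples_in k d" for p
  proof -
    have "p \<in> (`) w ` ktuples_in k d"
      using bij p by (simp add: bij_betw_def)
    then obtain q where q: "q \<in> ktuples_in k d" "p = w ` q"
      by blast
    then have "inv' w ` p = q"
      using permutes_inj[OF w] by (simp add: image_inv_f_f)
    then show ?thesis
      using q by simp
  qed
  then show ?thesis
    using assms(1,2) w by (simp add: Bperms_iff permutes_inv)
qed

lemma Bgroup_is_group:
  assumes "0 < k"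
  shows "group (Bgroup k n)"
proof (rule groupI)
  show "\<one>\<^bsub>Bgroup k n\<^esub> \<in> carrier (Bgroup k n)"
    by (simp add: Bgroup_def Bperms_iff[OF assms is_ktuple_union_atLeastAtMost] permutes_id del: One_nat_def)
  show "\<exists>v \<in> carrier (Bgroup k n). v \<otimes>\<^bsub>Bgroup k n\<^esub> w = \<one>\<^bsub>Bgroup k n\<^esub>"
    if w: "w \<in> carrier (Bgroup k n)" for w
  proof (rule bexI[of _ "inv' w"])
    show "inv' w \<in> carrier (Bgroup k n)"
      using Bperms_inv[OF assms is_ktuple_union_atLeastAtMost] w by (simp add: Bgroup_def)
    show "inv' w \<otimes>\<^bsub>Bgroup k n\<^esub> w = \<one>\<^bsub>Bgroup k n\<^esub>"
      using w by (auto simp: Bgroup_def Bperms_def permutes_inv_o)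
  qed
qed (auto simp: Bgroup_def Bperms_comp[OF assms is_ktuple_union_atLeastAtMost] comp_assoc
    simp del: One_nat_def)

lemma inv_Bgroup:
  assumes "0 < k" "w \<in> carrier (Bgroup k n)"
  shows "inv\<^bsub>Bgroup k n\<^esub> w = inv' w"
proof (rule group.inv_equality[OF Bgroup_is_group[OF assms(1)]])
  show "inv' w \<otimes>\<^bsub>Bgroup k n\<^esub> w = \<one>\<^bsub>Bgroup k n\<^esub>"
    using assms(2) by (auto simp: Bgroup_def Bperms_def permutes_inv_o)
  show "inv' w \<in> carrier (Bgroup k n)"
    using Bperms_inv[OF assms(1) is_ktuple_union_atLeastAtMost] assms(2) by (simp add: Bgroup_def)
qed (fact assms(2))

lemma finite_Bgroup: "finite (carrier (Bgroup k n))"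
  by (rule finite_subset[OF _ finite_permutations[of "{1..k * n}"]]) (auto simp: Bgroup_def Bperms_def)

section \<open>The semigroup of partial permutations and the conjugation action\<close>

text \<open>Separates the group element from the domain, which now only restricts its
  support.\<close>

lemma carrier_partial_perms:
  assumes "0 < k"
  shows "carrier (partial_perms k n) = {(d, w). d \<subseteq> {1..k * n} \<and> is_ktuple_union k d \<and>
    w \<in> carrier (Bgroup k n) \<and> w permutes d}"
  using Bperms_subset_iff[OF assms _ is_ktuple_union_atLeastAtMost]
  by (auto simp: partial_perms_def Bgroup_def)

lemma finite_partial_perms:
  assumes "0 < k"
  shows "finite (carrier (partial_perms k n))"
  by (rule finite_subset[of _ "Pow {1..k * n} \<times> carrier (Bgroup k n)"])
    (auto simp: carrier_partial_perms[OF assms] finite_Bgroup)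

lemma partial_perms_closed:
  assumes "0 < k" "x \<in> carrier (partial_perms k n)" "y \<in> carrier (partial_perms k n)"
  shows "x \<otimes>\<^bsub>partial_perms k n\<^esub> y \<in> carrier (partial_perms k n)"
proof -
  have "v \<circ> w permutes d \<union> e" if "v permutes d" "w permutes e" for v w :: "nat \<Rightarrow> nat" and d e
    using that by (intro permutes_compose) (auto intro: permutes_subset)
  then show ?thesis
    using assms(2,3) monoid.m_closed[OF group.is_monoid[OF Bgroup_is_group[OF assms(1)]], of _ n]
    by (auto simp: carrier_partial_perms[OF assms(1)] is_ktuple_union_Un)
      (auto simp: partial_perms_def Bgroup_def is_ktuple_union_Un)
qed

text \<open>An arbitrary permutation need not send tuples to tuples; elements of the group do, and
  one inclusion applied to \<open>s\<close> and to its inverse gives both.\<close>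

lemma ktuples_in_image:
  assumes k: "0 < k" and s: "s \<in> carrier (Bgroup k n)" and d: "d \<subseteq> {1..k * n}"
  shows "ktuples_in k (s ` d) = (`) s ` ktuples_in k d"
proof -
  have image: "v ` p \<in> ktuples_in k (v ` e)"
    if "v \<in> carrier (Bgroup k n)" "e \<subseteq> {1..k * n}" "p \<in> ktuples_in k e" for v p e
  proof -
    have "p \<in> ktuples_in k {1..k * n}"
      using that(2,3) by (auto simp: ktuples_in_def)
    then have "v ` p \<in> ktuples_in k {1..k * n}"
      using that(1) by (simp add: Bgroup_def Bperms_iff[OF k is_ktuple_union_atLeastAtMost] del: One_nat_def)
    then show ?thesis
      using that(3) by (auto simp: ktuples_in_def)
  qed
  have perm: "s permutes {1..k * n}" and inv_s: "inv' s \<in> carrier (Bgroup k n)"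
    using s Bperms_inv[OF k is_ktuple_union_atLeastAtMost] by (auto simp: Bgroup_def Bperms_def)
  have sd: "s ` d \<subseteq> {1..k * n}"
    using d permutes_image[OF perm] by blast
  have "p \<in> (`) s ` ktuples_in k d" if "p \<in> ktuples_in k (s ` d)" for p
  proof -
    have "inv' s ` p \<in> ktuples_in k d"
      using image[OF inv_s sd that] permutes_inj[OF perm] by (simp add: image_inv_f_f)
    moreover have "p = s ` (inv' s ` p)"
      using permutes_surj[OF perm] by (simp add: image_f_inv_f)
    ultimately show ?thesis
      by blast
  qed
  then show ?thesis
    using image[OF s d] by blast
qed

definition conj_action :: "(nat \<Rightarrow> nat) \<Rightarrow> nat set \<times> (nat \<Rightarrow> nat) \<Rightarrow> nat set \<times> (nat \<Rightarrow> nat)" where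
  "conj_action s = (\<lambda>(d, w). (s ` d, s \<circ> w \<circ> inv' s))"

lemma bij_Bgroup: "s \<in> carrier (Bgroup k n) \<Longrightarrow> bij s"
  by (auto simp: Bgroup_def Bperms_def permutes_bij)

lemma conj_action_closed:
  assumes k: "0 < k" and s: "s \<in> carrier (Bgroup k n)" and x: "x \<in> carrier (partial_perms k n)"
  shows "conj_action s x \<in> carrier (partial_perms k n)"
proof -
  obtain d w where x_eq: "x = (d, w)"
    by force
  then have d: "d \<subseteq> {1..k * n}" "is_ktuple_union k d" and w: "w \<in> Bperms k d"
    using x by (auto simp: partial_perms_def)
  have T: "ktuples_in k (s ` d) = (`) s ` ktuples_in k d"
    by (rule ktuples_in_image[OF k s d(1)])
  have Ud: "\<Union>((`) s ` ktuples_in k d) = s ` d"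
    using d(2) k by (simp add: is_ktuple_union_iff flip: image_Union)
  then have sd: "is_ktuple_union k (s ` d)"
    using d(2) k T by (simp add: is_ktuple_union_iff)
  interpret b: block_permutation "(`) s ` ktuples_in k d" k "s \<circ> w \<circ> inv' s"
    by (rule block_permutation_conj[OF block_permutation_Bperms[OF k d(2) w] bij_Bgroup[OF s]])
  have "s \<circ> w \<circ> inv' s \<in> Bperms k (s ` d)"
    unfolding Bperms_iff[OF k sd] using b.permutes_Union b.image_block Ud T by simp
  moreover have "s ` d \<subseteq> {1..k * n}"
    using d(1) s permutes_image[of s] by (auto simp: Bgroup_def Bperms_def)
  ultimately show ?thesis
    using sd by (simp add: x_eq conj_action_def partial_perms_def)
qed

lemma perm_type_conj:
  assumes k: "0 < k" and s: "s \<in> carrier (Bgroup k n)" and x: "(d, w) \<in> carrier (partial_perms k n)"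
  shows "perm_type k (s ` d) (s \<circ> w \<circ> inv' s) = perm_type k d w"
proof -
  have "d \<subseteq> {1..k * n}" "is_ktuple_union k d" "w \<in> Bperms k d"
    using x by (auto simp: partial_perms_def)
  then show ?thesis
    using block_type_conj[OF block_permutation_Bperms[OF k] bij_Bgroup[OF s]]
    by (simp add: perm_type_eq_block_type ktuples_in_image[OF k s])
qed

text \<open>The explicit left inverse gives injectivity, and finiteness of the carrier then gives
  surjectivity.\<close>

lemma conj_action_iso:
  assumes k: "0 < k" and s: "s \<in> carrier (Bgroup k n)"
  shows "conj_action s \<in> iso (partial_perms k n) (partial_perms k n)"
proof -
  have inv: "inv' s (s x) = x" for x
    using bij_Bgroup[OF s] by (simp add: bij_is_inj)
  have "inj_on (conj_action s) (carrier (partial_perms k n))"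
  proof (rule inj_on_inverseI)
    show "(\<lambda>(d, w). (inv' s ` d, inv' s \<circ> w \<circ> s)) (conj_action s x) = x" for x
      by (cases x) (simp add: conj_action_def image_image fun_eq_iff inv)
  qed
  moreover have "conj_action s ` carrier (partial_perms k n) \<subseteq> carrier (partial_perms k n)"
    using conj_action_closed[OF k s] by blast
  ultimately have "bij_betw (conj_action s) (carrier (partial_perms k n)) (carrier (partial_perms k n))"
    using finite_partial_perms[OF k] by (simp add: bij_betw_def endo_inj_surj)
  moreover have "conj_action s (x \<otimes>\<^bsub>partial_perms k n\<^esub> y) =
      conj_action s x \<otimes>\<^bsub>partial_perms k n\<^esub> conj_action s y" for x y
    by (cases x; cases y) (simp add: partial_perms_def conj_action_def image_Un fun_eq_iff inv)
  ultimately show ?thesis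
    using conj_action_closed[OF k s] by (simp add: iso_def hom_def)
qed

lemma partial_conj_class_conj_action:
  assumes k: "0 < k" and s: "s \<in> carrier (Bgroup k n)" and x: "x \<in> carrier (partial_perms k n)"
  shows "conj_action s x \<in> partial_conj_class k n \<Lambda> \<longleftrightarrow> x \<in> partial_conj_class k n \<Lambda>"
proof -
  obtain d w where x_eq: "x = (d, w)"
    by force
  have "card (s ` d) = card d"
    using bij_is_inj[OF bij_Bgroup[OF s]] by (simp add: card_image inj_on_subset)
  then show ?thesis
    using x conj_action_closed[OF k s x] perm_type_conj[OF k s, of d w]
    by (simp add: x_eq partial_conj_class_def conj_action_def)
qed

section \<open>The projection\<close>

lemma conjugate_of_perm_type_eq:
  assumes k: "0 < k" and v: "v \<in> carrier (Bgroup k n)" and w: "w \<in> carrier (Bgroup k n)"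
    and type: "perm_type k {1..k * n} v = perm_type k {1..k * n} w"
  obtains g where "g \<in> carrier (Bgroup k n)"
    "w = g \<otimes>\<^bsub>Bgroup k n\<^esub> v \<otimes>\<^bsub>Bgroup k n\<^esub> inv\<^bsub>Bgroup k n\<^esub> g"
proof -
  let ?T = "ktuples_in k {1..k * n}"
  note U = is_ktuple_union_atLeastAtMost[of k n]
  have UT: "\<Union>?T = {1..k * n}"
    using U k by (metis is_ktuple_union_iff)
  have "block_permutation ?T k v" "block_permutation ?T k w"
    using v w block_permutation_Bperms[OF k U] by (simp_all add: Bgroup_def)
  then obtain g where g: "g permutes \<Union>?T" "\<forall>p \<in> ?T. g ` p \<in> ?T" "g \<circ> v = w \<circ> g"
    using conjugate_of_block_type_eq type unfolding perm_type_eq_block_type by metis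
  have gB: "g \<in> carrier (Bgroup k n)"
    using g(1,2) UT Bperms_iff[OF k U, of g] by (simp add: Bgroup_def)
  have "w = g \<circ> v \<circ> inv' g"
    using permutes_surj[OF g(1)] by (simp add: g(3) comp_assoc surj_iff)
  then have "w = g \<otimes>\<^bsub>Bgroup k n\<^esub> v \<otimes>\<^bsub>Bgroup k n\<^esub> inv\<^bsub>Bgroup k n\<^esub> g"
    unfolding inv_Bgroup[OF k gB] by (simp add: Bgroup_def)
  with gB show thesis
    by (rule that)
qed

lemma psi_eq_sum:
  assumes k: "0 < k" and f: "f \<in> carrier (monoid_algebra (partial_perms k n))"
  shows "psi f w = (\<Sum>x \<in> carrier (partial_perms k n). if snd x = w then f x else 0)"
proof -
  have "{x. f x \<noteq> 0} \<subseteq> carrier (partial_perms k n)"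
    using f by (simp add: monoid_algebra_def)
  then have "psi f w = (\<Sum>x \<in> {x \<in> carrier (partial_perms k n). snd x = w}. f x)"
    unfolding psi_def snd_def[symmetric] by (rule linear_extension_finite[OF finite_partial_perms[OF k]])
  also have "\<dots> = (\<Sum>x \<in> carrier (partial_perms k n). if snd x = w then f x else 0)"
    by (rule sum.inter_filter[OF finite_partial_perms[OF k]])
  finally show ?thesis .
qed

lemma indicator_partial_conj_class_carrier:
  assumes "0 < k"
  shows "indicator (partial_conj_class k n \<Lambda>) \<in> carrier (monoid_algebra (partial_perms k n))"
  unfolding carrier_monoid_algebra_finite[OF finite_partial_perms[OF assms]]
  by (auto simp: partial_conj_class_def indicator_def)

lemma psi_indicator:
  assumes k: "0 < k"
  shows "psi (indicator (partial_conj_class k n \<Lambda>)) w = of_nat (card {d. (d, w) \<in> partial_conj_class k n \<Lambda>})"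
proof -
  let ?P = "carrier (partial_perms k n)" and ?C = "partial_conj_class k n \<Lambda>"
  have C: "?C \<subseteq> ?P"
    by (auto simp: partial_conj_class_def)
  have "psi (indicator ?C) w = (\<Sum>x \<in> ?P. if x \<in> {x \<in> ?C. snd x = w} then 1 else 0)"
    unfolding psi_eq_sum[OF k indicator_partial_conj_class_carrier[OF k]]
    by (intro sum.cong) (auto simp: indicator_def)
  also have "\<dots> = of_nat (card (?P \<inter> {x \<in> ?C. snd x = w}))"
    by (simp add: sum.If_cases[OF finite_partial_perms[OF k]])
  also have "?P \<inter> {x \<in> ?C. snd x = w} = (\<lambda>d. (d, w)) ` {d. (d, w) \<in> ?C}"
    using C by auto
  also have "card \<dots> = card {d. (d, w) \<in> ?C}"
    by (simp add: card_image inj_on_def)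
  finally show ?thesis .
qed

lemma invariant_algebra_conj_action:
  assumes k: "0 < k" and f: "f \<in> invariant_algebra k n" and s: "s \<in> carrier (Bgroup k n)"
  shows "f \<in> carrier (monoid_algebra (partial_perms k n)) \<and>
    (\<forall>x \<in> carrier (partial_perms k n). f (conj_action s x) = f x)"
proof (rule generate_algebra_invariant[OF finite_partial_perms[OF k] _ _ _ conj_action_iso[OF k s]])
  have "is_ktuple_union k {}"
    unfolding is_ktuple_union_def by (intro exI[of _ "{}"]) simp
  then show "\<one>\<^bsub>partial_perms k n\<^esub> \<in> carrier (partial_perms k n)"
    using Bperms_iff[OF k, of "{}" id] by (simp add: partial_perms_def permutes_id)
  show "conj_action s \<one>\<^bsub>partial_perms k n\<^esub> = \<one>\<^bsub>partial_perms k n\<^esub>"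
    using bij_is_surj[OF bij_Bgroup[OF s]] by (simp add: partial_perms_def conj_action_def surj_iff)
  show "f \<in> generate_algebra (monoid_algebra (partial_perms k n))
      {indicator (partial_conj_class k n \<Lambda>) | \<Lambda>. \<Lambda> \<in> partition_families k \<and> family_size k \<Lambda> \<le> n}"
    using f by (simp add: invariant_algebra_def)
qed (auto simp: partial_perms_closed[OF k] indicator_partial_conj_class_carrier[OF k]
    partial_conj_class_conj_action[OF k s] indicator_def)

lemma psi_invariant_algebra_central:
  assumes k: "0 < k" and f: "f \<in> invariant_algebra k n"
  shows "psi f \<in> algebra_center (monoid_algebra (Bgroup k n))"
proof -
  let ?P = "carrier (partial_perms k n)" and ?B = "Bgroup k n"
  interpret group ?B
    by (rule Bgroup_is_group[OF k])
  have fP: "f \<in> carrier (monoid_algebra (partial_perms k n))"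
    using invariant_algebra_conj_action[OF k f one_closed] by blast
  have "psi f w = 0" if "w \<notin> carrier ?B" for w
    unfolding psi_eq_sum[OF k fP] using that
    by (intro sum.neutral) (auto simp: carrier_partial_perms[OF k])
  moreover have "psi f (s \<otimes>\<^bsub>?B\<^esub> w \<otimes>\<^bsub>?B\<^esub> inv\<^bsub>?B\<^esub> s) = psi f w"
    if s: "s \<in> carrier ?B" for s w
  proof -
    have bij: "bij_betw (conj_action s) ?P ?P"
      using conj_action_iso[OF k s] by (simp add: iso_def)
    have inj: "s \<circ> v \<circ> inv' s = s \<circ> w \<circ> inv' s \<longleftrightarrow> v = w" for v
    proof
      assume eq: "s \<circ> v \<circ> inv' s = s \<circ> w \<circ> inv' s"
      show "v = w"
      proof
        show "v x = w x" for x
          using fun_cong[OF eq, of "s x"] bij_is_inj[OF bij_Bgroup[OF s]] by (simp add: inj_eq)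
      qed
    qed simp
    have "psi f (s \<otimes>\<^bsub>?B\<^esub> w \<otimes>\<^bsub>?B\<^esub> inv\<^bsub>?B\<^esub> s) = psi f (s \<circ> w \<circ> inv' s)"
      unfolding inv_Bgroup[OF k s] by (simp add: Bgroup_def)
    \<comment> \<open>Reindexing by the action of \<open>s\<close> moves the fibre over the
      conjugate back to the fibre over \<open>w\<close>.\<close>
    also have "\<dots> = (\<Sum>x \<in> ?P. if snd (conj_action s x) = s \<circ> w \<circ> inv' s then f (conj_action s x) else 0)"
      unfolding psi_eq_sum[OF k fP] by (rule sum.reindex_bij_betw[OF bij, symmetric])
    also have "\<dots> = (\<Sum>x \<in> ?P. if snd x = w then f x else 0)"
    proof (intro sum.cong refl)
      fix x assume x: "x \<in> ?P"
      have "snd (conj_action s x) = s \<circ> w \<circ> inv' s \<longleftrightarrow> snd x = w"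
        using inj by (simp add: conj_action_def case_prod_beta)
      then show "(if snd (conj_action s x) = s \<circ> w \<circ> inv' s then f (conj_action s x) else 0) =
          (if snd x = w then f x else 0)"
        using invariant_algebra_conj_action[OF k f s] x by simp
    qed
    also have "\<dots> = psi f w"
      unfolding psi_eq_sum[OF k fP] ..
    finally show ?thesis .
  qed
  ultimately show ?thesis
    unfolding algebra_center_group_algebra[OF finite_Bgroup] carrier_monoid_algebra_finite[OF finite_Bgroup]
    by blast
qed

lemma card_ktuples_in_atLeastAtMost:
  assumes "0 < k"
  shows "card (ktuples_in k {1..k * n}) = n"
  using card_ktuple_union[OF assms is_ktuple_union_atLeastAtMost[of k n]] assms by simp

lemma central_in_psi_invariant_algebra:
  assumes k: "0 < k" and f: "f \<in> algebra_center (monoid_algebra (Bgroup k n))"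
  shows "f \<in> psi ` invariant_algebra k n"
proof -
  let ?P = "carrier (partial_perms k n)" and ?B = "Bgroup k n" and ?d = "{1..k * n}"
  interpret group ?B
    by (rule Bgroup_is_group[OF k])
  note U = is_ktuple_union_atLeastAtMost[of k n]
  have f0: "f w = 0" if "w \<notin> carrier ?B" for w
    using f that unfolding algebra_center_group_algebra[OF finite_Bgroup]
      carrier_monoid_algebra_finite[OF finite_Bgroup] by blast
  have class_fun: "f v = f w" if "v \<in> carrier ?B" "w \<in> carrier ?B" "perm_type k ?d v = perm_type k ?d w" for v w
    using conjugate_of_perm_type_eq[OF k that] f that(1) unfolding algebra_center_group_algebra[OF finite_Bgroup]
    by (metis (mono_tags, lifting) mem_Collect_eq)
  \<comment> \<open>\<open>f\<close> is constant on elements of equal type, so any representative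
    gives the coefficient of its class.\<close>
  define c where "c \<Lambda> = f (SOME w. w \<in> carrier ?B \<and> perm_type k ?d w = \<Lambda>)" for \<Lambda>
  have c: "c (perm_type k ?d w) = f w" if w: "w \<in> carrier ?B" for w
  proof -
    let ?v = "SOME v. v \<in> carrier ?B \<and> perm_type k ?d v = perm_type k ?d w"
    have "?v \<in> carrier ?B \<and> perm_type k ?d ?v = perm_type k ?d w"
      by (rule someI[of "\<lambda>v. v \<in> carrier ?B \<and> perm_type k ?d v = perm_type k ?d w" w]) (simp add: w)
    then show ?thesis
      unfolding c_def using class_fun w by blast
  qed
  \<comment> \<open>Indexing by the types that occur makes finiteness a consequence of the
    finiteness of the group, and every index has a representative.\<close>
  define L where "L = perm_type k ?d ` carrier ?B"
  define F :: "nat set \<times> (nat \<Rightarrow> nat) \<Rightarrow> complex"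
    where "F x = (\<Sum>\<Lambda> \<in> L. c \<Lambda> * indicator (partial_conj_class k n \<Lambda>) x)" for x
  have L: "\<Lambda> \<in> partition_families k" "family_size k \<Lambda> = n" if \<Lambda>: "\<Lambda> \<in> L" for \<Lambda>
  proof -
    obtain w where w: "w \<in> carrier ?B" "\<Lambda> = block_type (ktuples_in k ?d) w"
      using \<Lambda> unfolding L_def perm_type_eq_block_type by blast
    interpret b: block_permutation "ktuples_in k ?d" k w
      using block_permutation_Bperms[OF k U] w(1) by (simp add: Bgroup_def)
    show "\<Lambda> \<in> partition_families k" "family_size k \<Lambda> = n"
      using b.block_type_in_partition_families b.family_size_block_type w(2)
        card_ktuples_in_atLeastAtMost[OF k] by simp_all
  qed
  have fin: "finite L"
    unfolding L_def using finite_Bgroup by blast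
  have F: "F \<in> invariant_algebra k n"
    unfolding invariant_algebra_def F_def using L by (intro sum_generate_algebra[OF fin]) auto
  \<comment> \<open>For the types in \<open>L\<close>, a domain of the required cardinality must be
    all of [kn]. So \<open>F\<close> is \<open>f\<close> placed on the pairs with full domain, and
    over each group element there is exactly one such pair.\<close>
  have F_eq: "F x = (if x = (?d, snd x) then f (snd x) else 0)" if x: "x \<in> ?P" for x
  proof -
    obtain d w where dw: "x = (d, w)"
      by force
    have d: "d \<subseteq> ?d" and w: "w \<in> carrier ?B"
      using x by (simp_all add: dw carrier_partial_perms[OF k])
    have "card d = k * n \<longleftrightarrow> d = ?d"
      using card_subset_eq[of ?d d] d by auto
    then have "(d, w) \<in> partial_conj_class k n \<Lambda> \<longleftrightarrow> d = ?d \<and> perm_type k ?d w = \<Lambda>" if "\<Lambda> \<in> L" for \<Lambda>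
      using x L(2)[OF that] by (auto simp: dw partial_conj_class_def)
    then have "F x = (\<Sum>\<Lambda> \<in> L. if perm_type k ?d w = \<Lambda> then (if d = ?d then c \<Lambda> else 0) else 0)"
      unfolding F_def dw by (intro sum.cong) (auto simp: indicator_def)
    also have "\<dots> = (if d = ?d then c (perm_type k ?d w) else 0)"
      using fin w by (simp add: L_def)
    finally show ?thesis
      using c[OF w] by (simp add: dw)
  qed
  have FP: "F \<in> carrier (monoid_algebra (partial_perms k n))"
    using invariant_algebra_conj_action[OF k F one_closed] by blast
  have "psi F w = f w" for w
  proof -
    have "psi F w = (\<Sum>x \<in> ?P. if x = (?d, w) then f w else 0)"
      unfolding psi_eq_sum[OF k FP] by (intro sum.cong refl) (auto simp: F_eq)
    also have "\<dots> = (if (?d, w) \<in> ?P then f w else 0)"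
      by (simp add: finite_partial_perms[OF k])
    also have "\<dots> = f w"
    proof (cases "w \<in> carrier ?B")
      case True
      then have "(?d, w) \<in> ?P"
        using U by (simp add: partial_perms_def Bgroup_def)
      then show ?thesis
        by simp
    qed (simp add: f0)
    finally show ?thesis .
  qed
  then show ?thesis
    using F by (intro image_eqI[of _ _ F]) auto
qed

section \<open>Coefficients of the image of a class sum\<close>

text \<open>Describes the fibre of \<open>psi\<close> over \<open>w\<close>: a domain is [kn] with
  some tuples deleted, and \<open>w\<close> permutes what is left precisely when it fixes the
  deleted tuples pointwise.\<close>

lemma partial_conj_class_iff:
  assumes k: "0 < k" and w: "w \<in> carrier (Bgroup k n)" and \<Lambda>: "family_size k \<Lambda> \<le> n"
    and T: "T = ktuples_in k {1..k * n}"
  shows "(d, w) \<in> partial_conj_class k n \<Lambda> \<longleftrightarrow>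
    perm_type k {1..k * n} w = complete_family k n \<Lambda> \<and>
    (\<exists>S \<subseteq> block_permutation.fixed_blocks T w. card S = n - family_size k \<Lambda> \<and> d = \<Union>(T - S))"
proof -
  note U = is_ktuple_union_atLeastAtMost[of k n]
  interpret block_permutation T k w
    unfolding T using block_permutation_Bperms[OF k U] w by (simp add: Bgroup_def)
  have UT: "\<Union>T = {1..k * n}"
    unfolding T using U k by (metis is_ktuple_union_iff)
  have card_T: "card T = n"
    unfolding T by (rule card_ktuples_in_atLeastAtMost[OF k])
  \<comment> \<open>Deleting \<open>S\<close> removes as many parts 1 at \<open>ones k\<close> as
    \<open>complete_family\<close> adds, so the equivalence is cancellation of a common
    summand.\<close>
  have type: "perm_type k {1..k * n} w = complete_family k n \<Lambda> \<longleftrightarrow> perm_type k d w = \<Lambda>"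
    if S: "S \<subseteq> fixed_blocks" "card S = n - family_size k \<Lambda>" "ktuples_in k d = T - S" for S d
    unfolding perm_type_eq_block_type T[symmetric] that(3) block_type_Diff_fixed_blocks[OF S(1)] complete_family_def S(2)
    by (auto simp: fun_eq_iff split: if_splits)
  show ?thesis
  proof (intro iffI conjI)
    assume "(d, w) \<in> partial_conj_class k n \<Lambda>"
    then have d: "d \<subseteq> {1..k * n}" "is_ktuple_union k d" "w permutes d"
      and card_d: "card d = k * family_size k \<Lambda>" and type_d: "perm_type k d w = \<Lambda>"
      by (auto simp: partial_conj_class_def carrier_partial_perms[OF k])
    define S where "S = T - ktuples_in k d"
    have sub: "ktuples_in k d \<subseteq> T"
      using d(1) unfolding T ktuples_in_def by blast
    then have kd: "ktuples_in k d = T - S"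
      unfolding S_def by blast
    have Ud: "\<Union>(ktuples_in k d) = d"
      using d(2) k by (simp add: is_ktuple_union_iff)
    \<comment> \<open>A tuple not contained in \<open>d\<close> is even disjoint from it, so all its
      points lie outside the support of \<open>w\<close>.\<close>
    have "p \<inter> d = {}" if "p \<in> S" for p
    proof (rule ccontr)
      assume "p \<inter> d \<noteq> {}"
      then obtain x q where "x \<in> p" "x \<in> q" "q \<in> ktuples_in k d"
        using Ud by blast
      then show False
        using that block_eqI sub unfolding S_def by blast
    qed
    then have S: "S \<subseteq> fixed_blocks"
      using d(3) unfolding fixed_blocks_def S_def by (auto simp: permutes_not_in disjoint_iff)
    have "card (ktuples_in k d) = family_size k \<Lambda>"
      using card_ktuple_union[OF k d(2)] card_d k by simp
    then have card_S: "card S = n - family_size k \<Lambda>"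
      unfolding S_def using sub card_T by (simp add: card_Diff_subset finite_blocks finite_subset)
    show "perm_type k {1..k * n} w = complete_family k n \<Lambda>"
      unfolding type[OF S card_S kd] by (rule type_d)
    show "\<exists>S \<subseteq> fixed_blocks. card S = n - family_size k \<Lambda> \<and> d = \<Union>(T - S)"
      using S card_S Ud kd by auto
  next
    assume asm: "perm_type k {1..k * n} w = complete_family k n \<Lambda> \<and>
      (\<exists>S \<subseteq> fixed_blocks. card S = n - family_size k \<Lambda> \<and> d = \<Union>(T - S))"
    then obtain S where S: "S \<subseteq> fixed_blocks" "card S = n - family_size k \<Lambda>" and d: "d = \<Union>(T - S)"
      by blast
    have S_T: "S \<subseteq> T"
      using S(1) by (auto simp: fixed_blocks_def)
    \<comment> \<open>No new tuple arises in the union: a tuple inside \<open>d\<close> shares a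
      point with one of the remaining blocks and therefore equals it.\<close>
    have kd: "ktuples_in k d = T - S"
    proof (intro equalityI subsetI)
      fix p assume p: "p \<in> ktuples_in k d"
      then have "p \<in> T"
        using d UT unfolding T ktuples_in_def by blast
      moreover obtain x where "x \<in> p"
        using card_ktuples_in[OF p] k by fastforce
      moreover from this obtain q where "q \<in> T - S" "x \<in> q"
        using ktuples_in_subset[OF p] d by blast
      ultimately show "p \<in> T - S"
        using block_eqI by blast
    next
      fix p assume "p \<in> T - S"
      then show "p \<in> ktuples_in k d"
        unfolding d T by (auto simp: ktuples_in_def)
    qed
    have "d \<subseteq> {1..k * n}"
      using d UT by blast
    moreover have un: "is_ktuple_union k d"
      using calculation d kd by (simp add: is_ktuple_union_iff[OF k] finite_subset)
    moreover have "w permutes d"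
    proof (rule permutes_superset[OF permutes_Union])
      fix x assume "x \<in> \<Union>T - d"
      then have "x \<in> \<Union>fixed_blocks"
        using d S(1) by blast
      then show "w x = x"
        by (auto simp: fixed_blocks_def)
    qed
    moreover have "card d = k * family_size k \<Lambda>"
      using card_ktuple_union[OF k un] kd S(2) card_T \<Lambda> S_T
      by (simp add: card_Diff_subset finite_blocks finite_subset)
    moreover have "perm_type k d w = \<Lambda>"
      using asm type[OF S kd] by blast
    ultimately show "(d, w) \<in> partial_conj_class k n \<Lambda>"
      using w by (simp add: partial_conj_class_def carrier_partial_perms[OF k])
  qed
qed

lemma card_partial_conj_class_fibre:
  assumes k: "0 < k" and w: "w \<in> carrier (Bgroup k n)" and \<Lambda>: "family_size k \<Lambda> \<le> n"
  shows "card {d. (d, w) \<in> partial_conj_class k n \<Lambda>} =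
    (if perm_type k {1..k * n} w = complete_family k n \<Lambda>
     then (n - family_size k \<Lambda> + count (\<Lambda> (ones k)) 1) choose count (\<Lambda> (ones k)) 1 else 0)"
proof (cases "perm_type k {1..k * n} w = complete_family k n \<Lambda>")
  case True
  define T where "T = ktuples_in k {1..k * n}"
  let ?m = "n - family_size k \<Lambda>"
  interpret block_permutation T k w
    unfolding T_def using block_permutation_Bperms[OF k is_ktuple_union_atLeastAtMost] w
    by (simp add: Bgroup_def)
  have fin: "finite fixed_blocks"
    using finite_blocks by (simp add: fixed_blocks_def)
  have fibre: "{d. (d, w) \<in> partial_conj_class k n \<Lambda>} =
      (\<lambda>S. \<Union>(T - S)) ` {S. S \<subseteq> fixed_blocks \<and> card S = ?m}"
    using True partial_conj_class_iff[OF k w \<Lambda> T_def] by auto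
  \<comment> \<open>\<open>S\<close> is recovered from the domain as the set of tuples not contained
    in it.\<close>
  have "inj_on (\<lambda>S. \<Union>(T - S)) {S. S \<subseteq> fixed_blocks \<and> card S = ?m}"
  proof (rule inj_on_inverseI)
    fix S assume "S \<in> {S. S \<subseteq> fixed_blocks \<and> card S = ?m}"
    then have S: "S \<subseteq> T"
      by (auto simp: fixed_blocks_def)
    have "p \<subseteq> \<Union>(T - S) \<longleftrightarrow> p \<notin> S" if p: "p \<in> T" for p
    proof
      assume sub: "p \<subseteq> \<Union>(T - S)"
      obtain x where "x \<in> p"
        using block_nonempty[OF p] by blast
      moreover from this obtain q where "q \<in> T - S" "x \<in> q"
        using sub by blast
      ultimately show "p \<notin> S"
        using block_eqI p by blast
    qed (use p in blast)
    then show "{p \<in> T. \<not> p \<subseteq> \<Union>(T - S)} = S"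
      using S by blast
  qed
  then have "card {d. (d, w) \<in> partial_conj_class k n \<Lambda>} = card fixed_blocks choose ?m"
    unfolding fibre by (simp add: card_image n_subsets[OF fin])
  also have "card fixed_blocks = count (complete_family k n \<Lambda> (ones k)) 1"
    using count_block_type_ones True by (simp add: perm_type_eq_block_type T_def)
  also have "\<dots> = ?m + count (\<Lambda> (ones k)) 1"
    by (simp add: complete_family_def)
  \<comment> \<open>Choosing which \<open>?m\<close> fixed tuples to delete amounts to choosing the
    ones to keep, which is the form of the coefficient in the statement.\<close>
  also have "\<dots> choose ?m = \<dots> choose count (\<Lambda> (ones k)) 1"
    using binomial_symmetric[of ?m "?m + count (\<Lambda> (ones k)) 1"] by simp
  finally show ?thesis
    using True by simp
next
  case False
  then have "{d. (d, w) \<in> partial_conj_class k n \<Lambda>} = {}"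
    using partial_conj_class_iff[OF k w \<Lambda> refl] by blast
  then show ?thesis
    using False by simp
qed

theorem mainTheorem6:
  fixes k n :: nat
  assumes "k > 0" and "n > 0"
  shows "psi ` invariant_algebra k n = algebra_center (monoid_algebra (Bgroup k n)) \<and>
    (\<forall>\<Lambda> \<in> partition_families k. family_size k \<Lambda> < n \<longrightarrow>
      psi (indicator (partial_conj_class k n \<Lambda>)) =
        of_nat ((n - family_size k \<Lambda> + count (\<Lambda> (ones k)) 1) choose count (\<Lambda> (ones k)) 1)
          \<odot>\<^bsub>monoid_algebra (Bgroup k n)\<^esub> indicator (conj_class k n (complete_family k n \<Lambda>)))"
proof (intro conjI ballI impI)
  show "psi ` invariant_algebra k n = algebra_center (monoid_algebra (Bgroup k n))"
    using psi_invariant_algebra_central[OF assms(1)] central_in_psi_invariant_algebra[OF assms(1)] by blast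
next
  fix \<Lambda> assume \<Lambda>: "family_size k \<Lambda> < n"
  show "psi (indicator (partial_conj_class k n \<Lambda>)) =
      of_nat ((n - family_size k \<Lambda> + count (\<Lambda> (ones k)) 1) choose count (\<Lambda> (ones k)) 1)
        \<odot>\<^bsub>monoid_algebra (Bgroup k n)\<^esub> indicator (conj_class k n (complete_family k n \<Lambda>))"
  proof
    fix w
    show "psi (indicator (partial_conj_class k n \<Lambda>)) w =
        (of_nat ((n - family_size k \<Lambda> + count (\<Lambda> (ones k)) 1) choose count (\<Lambda> (ones k)) 1)
          \<odot>\<^bsub>monoid_algebra (Bgroup k n)\<^esub> indicator (conj_class k n (complete_family k n \<Lambda>))) w"
    \<comment> \<open>Inside the group the coefficient is the size of the fibre; outside it the
      fibre is empty and both sides vanish.\<close>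
    proof (cases "w \<in> carrier (Bgroup k n)")
      case True
      then show ?thesis
        using \<Lambda> card_partial_conj_class_fibre[OF assms(1) True, of \<Lambda>]
        by (simp add: psi_indicator[OF assms(1)] monoid_algebra_def conj_class_def indicator_def)
    next
      case False
      then have "{d. (d, w) \<in> partial_conj_class k n \<Lambda>} = {}"
        by (auto simp: partial_conj_class_def carrier_partial_perms[OF assms(1)])
      then show ?thesis
        using False by (simp add: psi_indicator[OF assms(1)] monoid_algebra_def conj_class_def indicator_def)
    qed
  qed
qed

end
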